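(* If $f:\mathbb{R}^q\to\mathbb{R}^q$ is a linear map, then $h_\infty(f)=\log\Lambda$, where $\Lambda$ is the absolute value of the product of all eigenvalues of $f$ that have absolute value larger than $1$.
   Context: $\mathbb{R}^q$ carries the Euclidean metric. Eigenvalues are complex eigenvalues counted with algebraic multiplicity; an empty product equals $1$. Coarse entropy: let $(X,d)$ be a nonempty metric space and $f:X\to X$ a map. A $\delta$-pseudoorbit of $f$ of length $n$ starting at $x_0$ is a sequence $(x_0,x_1,\dots,x_n)$ in $X$ with $d(f(x_i),x_{i+1})\le\delta$ for $i=0,\dots,n-1$. The distance between $(x_0,\dots,x_n)$ and $(y_0,\dots,y_n)$ is $\max_{0\le i\le n}d(x_i,y_i)$. A set is $R$-separated if any two distinct elements are at distance at least $R$. Let $s(f,n,R,\delta,x_0)\in[1,\infty]$ be the supremum of cardinalities of $R$-separated sets of $\delta$-pseudoorbits of $f$ of length $n$ starting at $x_0$. The coarse entropy of $f$ is $$h_\infty(f)=\lim_{\delta\to\infty}\lim_{R\to\infty}\limsup_{n\to\infty}\frac1n\log s(f,n,R,\delta,x_0)\in[0,\infty];$$ it does not depend on the choice of $x_0\in X$ (and the limits in $R$ and $\delta$ exist by monotonicity). *)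

theory Defs
  imports
    "HOL-Analysis.Analysis"
    "HOL-Computational_Algebra.Polynomial"
begin

section \<open>Coarse entropy\<close>

text \<open>A sequence \<open>(x\<^sub>0, \<dots>, x\<^sub>n)\<close> is represented by a list of length \<open>n + 1\<close>.\<close>

definition pseudoorbits :: "('a::metric_space \<Rightarrow> 'a) \<Rightarrow> nat \<Rightarrow> real \<Rightarrow> 'a \<Rightarrow> 'a list set" where
  "pseudoorbits f n \<delta> x0 =
     {xs. length xs = Suc n \<and> xs ! 0 = x0 \<and> (\<forall>i<n. dist (f (xs ! i)) (xs ! Suc i) \<le> \<delta>)}"

definition orbit_dist :: "nat \<Rightarrow> 'a::metric_space list \<Rightarrow> 'a list \<Rightarrow> real" where
  "orbit_dist n xs ys = Max ((\<lambda>i. dist (xs ! i) (ys ! i)) ` {0..n})"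

definition R_separated :: "nat \<Rightarrow> real \<Rightarrow> 'a::metric_space list set \<Rightarrow> bool" where
  "R_separated n R S \<longleftrightarrow> (\<forall>xs\<in>S. \<forall>ys\<in>S. xs \<noteq> ys \<longrightarrow> R \<le> orbit_dist n xs ys)"

text \<open>Cardinality in \<open>[0, \<infinity>]\<close>; \<^const>\<open>card\<close> is \<open>0\<close> on infinite sets.\<close>

definition ext_card :: "'a set \<Rightarrow> ereal" where
  "ext_card S = (if finite S then ereal (real (card S)) else \<infinity>)"

definition sep_number :: "('a::metric_space \<Rightarrow> 'a) \<Rightarrow> nat \<Rightarrow> real \<Rightarrow> real \<Rightarrow> 'a \<Rightarrow> ereal" where
  "sep_number f n R \<delta> x0 =
     (SUP S \<in> {S. S \<subseteq> pseudoorbits f n \<delta> x0 \<and> R_separated n R S}. ext_card S)"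

text \<open>
  The value at nonpositive arguments only concerns \<open>\<delta> < 0\<close>, where there may be no pseudoorbits;
  for \<open>\<delta> \<ge> 0\<close> the orbit of \<open>x0\<close> shows \<^term>\<open>sep_number f n R \<delta> x0 \<ge> 1\<close>.
\<close>

definition ext_ln :: "ereal \<Rightarrow> ereal" where
  "ext_ln x = (if x = \<infinity> then \<infinity> else if x \<le> 0 then - \<infinity> else ereal (ln (real_of_ereal x)))"

text \<open>The term for \<open>n = 0\<close> is junk, but irrelevant for the limit superior.\<close>

definition sep_growth :: "('a::metric_space \<Rightarrow> 'a) \<Rightarrow> real \<Rightarrow> real \<Rightarrow> 'a \<Rightarrow> ereal" where
  "sep_growth f R \<delta> x0 = limsup (\<lambda>n. ereal (1 / real n) * ext_ln (sep_number f n R \<delta> x0))"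

definition coarse_entropy :: "('a::metric_space \<Rightarrow> 'a) \<Rightarrow> 'a \<Rightarrow> ereal" where
  "coarse_entropy f x0 = Lim at_top (\<lambda>\<delta>. Lim at_top (\<lambda>R. sep_growth f R \<delta> x0))"

text \<open>\<^const>\<open>Lim\<close> is unspecified for divergent functions; both limits above exist by monotonicity.\<close>

lemma antimono_tendsto_INF:
  fixes g :: "real \<Rightarrow> ereal"
  assumes "antimono g"
  shows "(g \<longlongrightarrow> (INF x. g x)) at_top"
proof (rule decreasing_tendsto)
  fix c assume "(INF x. g x) < c"
  then obtain x where "g x < c" by (auto simp: INF_less_iff)
  then show "\<forall>\<^sub>F y in at_top. g y < c"
    using antimonoD[OF assms] order.strict_trans1
    by (intro eventually_mono[OF eventually_ge_at_top[of x]]) blast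
qed (simp add: INF_lower)

lemma mono_tendsto_SUP:
  fixes g :: "real \<Rightarrow> ereal"
  assumes "mono g"
  shows "(g \<longlongrightarrow> (SUP x. g x)) at_top"
proof (rule increasing_tendsto)
  fix c assume "c < (SUP x. g x)"
  then obtain x where "c < g x" by (auto simp: less_SUP_iff)
  then show "\<forall>\<^sub>F y in at_top. c < g y"
    using monoD[OF assms] order.strict_trans2
    by (intro eventually_mono[OF eventually_ge_at_top[of x]]) blast
qed (simp add: SUP_upper)

lemma ext_ln_mono: "x \<le> y \<Longrightarrow> ext_ln x \<le> ext_ln y"
  unfolding ext_ln_def by (cases x; cases y) auto

lemma sep_number_mono:
  assumes "R' \<le> R" "\<delta> \<le> \<delta>'"
  shows "sep_number f n R \<delta> x0 \<le> sep_number f n R' \<delta>' x0"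
  unfolding sep_number_def
proof (rule SUP_subset_mono)
  show "{S. S \<subseteq> pseudoorbits f n \<delta> x0 \<and> R_separated n R S} \<subseteq>
        {S. S \<subseteq> pseudoorbits f n \<delta>' x0 \<and> R_separated n R' S}"
    using assms unfolding pseudoorbits_def R_separated_def by fastforce
qed simp

lemma sep_growth_mono:
  assumes "R' \<le> R" "\<delta> \<le> \<delta>'"
  shows "sep_growth f R \<delta> x0 \<le> sep_growth f R' \<delta>' x0"
  unfolding sep_growth_def
  by (intro Limsup_mono always_eventually allI ereal_mult_left_mono ext_ln_mono
        sep_number_mono assms) simp

lemma sep_growth_tendsto:
  "((\<lambda>R. sep_growth f R \<delta> x0) \<longlongrightarrow> (INF R. sep_growth f R \<delta> x0)) at_top"
  by (intro antimono_tendsto_INF antimonoI sep_growth_mono) auto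

lemma Lim_sep_growth: "Lim at_top (\<lambda>R. sep_growth f R \<delta> x0) = (INF R. sep_growth f R \<delta> x0)"
  by (intro tendsto_Lim sep_growth_tendsto) simp

lemma coarse_entropy_tendsto:
  "((\<lambda>\<delta>. Lim at_top (\<lambda>R. sep_growth f R \<delta> x0)) \<longlongrightarrow> coarse_entropy f x0) at_top"
proof -
  have "mono (\<lambda>\<delta>. INF R. sep_growth f R \<delta> x0)"
    by (intro monoI INF_mono') (simp add: sep_growth_mono)
  from mono_tendsto_SUP[OF this] show ?thesis
    unfolding coarse_entropy_def Lim_sep_growth by (simp add: tendsto_Lim)
qed

section \<open>Eigenvalues\<close>

text \<open>The characteristic polynomial \<open>det (X \<cdot> 1 - A)\<close>, a determinant over the ring of polynomials.\<close>

definition charpoly :: "complex ^ 'n ^ 'n \<Rightarrow> complex poly" where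
  "charpoly A = det (mat [:0, 1:] - (\<chi> i j. [:A $ i $ j:]))"

text \<open>\<^const>\<open>proots\<close> counts every root with its order, hence eigenvalues with algebraic multiplicity.\<close>

definition complex_eigenvalues :: "(real ^ 'n \<Rightarrow> real ^ 'n) \<Rightarrow> complex multiset" where
  "complex_eigenvalues f = proots (charpoly (\<chi> i j. complex_of_real (matrix f $ i $ j)))"

end

theory Submission
  imports Defs "HOL-Computational_Algebra.Fundamental_Theorem_Algebra"
begin

text \<open>
  The real map \<open>f\<close> is replaced by its complexification \<open>A\<close> on \<open>\<complex>\<^sup>q\<close>. As a real map, \<open>A\<close> is the direct sum of
  two copies of \<open>f\<close>, so a pair of pseudoorbits of \<open>f\<close> is one pseudoorbit of \<open>A\<close>, and separation numbers of
  \<open>A\<close> are comparable with squares of those of \<open>f\<close>. Over \<open>\<complex>\<close> there are an invertible \<open>Q\<close> and a triangular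
  \<open>T\<close> with \<open>Q A = T Q\<close> (\<open>triangularization\<close>); the diagonal of \<open>T\<close> lists the eigenvalues
  \<open>\<lambda>\<^sub>i\<close> with multiplicity (\<open>charpoly_triangularization\<close>), so \<open>ln \<Lambda> = \<Sum>\<^sub>i ln (max 1 \<bar>\<lambda>\<^sub>i\<bar>)\<close>.

  Upper bound. In the coordinates \<open>u = Q x\<close> each \<open>u\<^sub>i\<close> is driven only by coordinates of smaller rank.
  Within a class of pseudoorbits whose coordinates of smaller rank stay within a fixed distance of each
  other, the difference of two \<open>u\<^sub>i\<close>'s satisfies \<open>d\<^sub>t\<^sub>+\<^sub>1 = \<lambda>\<^sub>i d\<^sub>t + O(1)\<close>. So everything reduces to one
  complex coordinate: there, looking only at every \<open>m\<close>-th time and subdividing the plane into squares,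
  a class splits into at most \<open>(10 (max 1 \<bar>\<lambda>\<bar>)\<^sup>m)\<^sup>2\<close> classes per \<open>m\<close> steps, and letting \<open>m\<close> grow absorbs the
  constant (\<open>scalar_cover\<close>). Refining the classes coordinate by coordinate covers the pseudoorbits of
  \<open>A\<close> of length \<open>n\<close> by \<open>C exp (n (2 ln \<Lambda> + \<epsilon>))\<close> sets whose members stay within a distance not
  depending on \<open>n\<close> of each other (\<open>linear_orbits_cover\<close>). A separated set \<open>S\<close> of pseudoorbits
  of \<open>f\<close> gives \<open>S \<times> S\<close> for \<open>A\<close>, and the square root halves the exponent.

  Lower bound. It suffices to make a single error, in the first step, and to follow exact orbits
  afterwards. Let the coordinate \<open>u\<^sub>i\<close> of the error run through a grid of mesh proportional to
  \<open>\<bar>\<lambda>\<^sub>i\<bar>\<^sup>-\<^sup>m\<close> (or only through \<open>0\<close> if \<open>\<bar>\<lambda>\<^sub>i\<bar> \<le> 1\<close>). If two errors first differ in coordinate \<open>i\<close>, that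
  coordinate of the difference is multiplied by \<open>\<lambda>\<^sub>i\<close> in every step, so after \<open>m\<close> steps the two orbits
  are far apart. This gives about \<open>\<Lambda>\<^bsup>2m\<^esup>\<close> separated orbits of \<open>A\<close>; comparing them with a maximal separated
  set of pseudoorbits of \<open>f\<close> (\<open>sqrt_card_le_sep_number\<close>) gives \<open>\<Lambda>\<^sup>m\<close> for \<open>f\<close>, for every \<open>R\<close> and with \<open>\<delta> = 1\<close>.
\<close>

section \<open>Triangularization and the characteristic polynomial\<close>

text \<open>
  The vector \<open>p(M) w\<close>, evaluated by Horner's scheme.
\<close>

definition krylov :: "complex ^ 'n ^ 'n \<Rightarrow> complex ^ 'n \<Rightarrow> complex poly \<Rightarrow> complex ^ 'n" where
  "krylov M w p = fold_coeffs (\<lambda>a u. a *s w + M *v u) p 0"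

lemma krylov_0 [simp]: "krylov M w 0 = 0"
  by (simp add: krylov_def)

lemma krylov_pCons [simp]: "krylov M w (pCons a p) = a *s w + M *v krylov M w p"
proof (cases "p = 0 \<and> a = 0")
  case True
  then show ?thesis by (simp add: krylov_def)
next
  case False
  then show ?thesis
    by (cases "a = 0") (auto simp: krylov_def)
qed

lemma krylov_add: "krylov M w (p + q) = krylov M w p + krylov M w q"
proof (induction p arbitrary: q)
  case (pCons a p)
  show ?case
  proof (cases q)
    case (pCons b q')
    have "krylov M w (pCons a p + q) = (a + b) *s w + M *v (krylov M w p + krylov M w q')"
      by (simp add: pCons pCons.IH[of q', symmetric])
    then show ?thesis
      by (simp add: pCons matrix_vector_right_distrib vec.scale_left_distrib)
  qed
qed simp

lemma krylov_smult: "krylov M w (smult c p) = c *s krylov M w p"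
  by (induction p) (simp_all add: vec.scale vec.scale_right_distrib)

lemma krylov_sum: "krylov M w (\<Sum>i\<in>I. p i) = (\<Sum>i\<in>I. krylov M w (p i))"
  by (induction I rule: infinite_finite_induct) (simp_all add: krylov_add)

lemma krylov_linear_factor:
  "krylov M w ([:- c, 1:] * p) = M *v krylov M w p - c *s krylov M w p"
proof -
  have "[:- c, 1:] * p = smult (- c) p + pCons 0 p" by simp
  then show ?thesis by (simp only: krylov_add krylov_smult krylov_pCons) simp
qed

text \<open>
  The \<open>q + 1\<close> vectors \<open>M\<^sup>i w\<close>, \<open>i \<le> q\<close>, are linearly dependent in \<open>\<complex>\<^sup>q\<close>.
\<close>

lemma annihilating_poly: "\<exists>p. p \<noteq> 0 \<and> krylov M w p = (0 :: complex ^ 'n)"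
proof (cases "inj_on (\<lambda>i. krylov M w (monom 1 i)) {..CARD('n)}")
  case False
  then obtain i j where ij: "i \<noteq> j" "krylov M w (monom 1 i) = krylov M w (monom 1 j)"
    by (auto simp: inj_on_def)
  have "krylov M w (monom 1 i + smult (-1) (monom 1 j)) = 0"
    using ij by (simp only: krylov_add krylov_smult) simp
  moreover have "monom 1 i + smult (-1) (monom 1 j) \<noteq> (0 :: complex poly)"
  proof
    assume "monom 1 i + smult (-1) (monom 1 j) = (0 :: complex poly)"
    then have "coeff (monom 1 i + smult (-1) (monom 1 j)) i = (0 :: complex)" by simp
    with ij show False by simp
  qed
  ultimately show ?thesis by blast
next
  case True
  let ?e = "\<lambda>i. krylov M w (monom 1 i)"
  have "card (?e ` {..CARD('n)}) = Suc CARD('n)"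
    using True by (simp add: card_image)
  then have "vec.dependent (?e ` {..CARD('n)})"
    using vec.dependent_biggerset_general[of "?e ` {..CARD('n)}"]
      vec.dim_subset_UNIV[of "?e ` {..CARD('n)}"]
    by (metis vec_dim_card vec.dimension_def vec.dim_UNIV le_imp_less_Suc)
  then obtain u where u: "\<exists>x\<in>?e ` {..CARD('n)}. u x \<noteq> 0"
      "(\<Sum>x\<in>?e ` {..CARD('n)}. u x *s x) = 0"
    by (subst (asm) vec.dependent_finite) auto
  let ?p = "\<Sum>i\<le>CARD('n). smult (u (?e i)) (monom 1 i)"
  have "krylov M w ?p = (\<Sum>i\<le>CARD('n). u (?e i) *s ?e i)"
    by (simp only: krylov_sum krylov_smult)
  also have "\<dots> = 0"
    using u(2) by (simp add: sum.reindex[OF True] o_def)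
  finally have "krylov M w ?p = 0" .
  moreover from u(1) obtain k where k: "k \<le> CARD('n)" "u (?e k) \<noteq> 0" by auto
  have "coeff ?p k = u (?e k)"
    using k(1) by (simp add: coeff_sum if_distrib sum.delta cong: if_cong)
  with k(2) have "?p \<noteq> 0" by (metis coeff_0)
  ultimately show ?thesis by blast
qed

text \<open>
  If \<open>p\<close> has minimal degree among the nonzero polynomials with \<open>p(M) w \<in> W\<close>, and \<open>p = (X - c) q\<close>, then
  \<open>v = q(M) w\<close> lies outside \<open>W\<close> and is an eigenvector modulo \<open>W\<close>. The subspace \<open>W\<close> need not be invariant.
\<close>

lemma eigenvector_mod_subspace:
  fixes M :: "complex ^ 'n ^ 'n"
  assumes "w \<notin> W" and W: "vec.subspace W"
  shows "\<exists>v c. v \<notin> W \<and> M *v v - c *s v \<in> W"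
proof -
  let ?S = "\<lambda>p. p \<noteq> 0 \<and> krylov M w p \<in> W"
  obtain p0 where "p0 \<noteq> 0" "krylov M w p0 = 0"
    using annihilating_poly[of M w] by auto
  then have "?S p0" using vec.subspace_0[OF W] by simp
  then obtain p where p: "?S p" and min: "\<And>q. ?S q \<Longrightarrow> degree p \<le> degree q"
    using ex_has_least_nat[of ?S p0 degree] by auto
  have "degree p \<noteq> 0"
  proof
    assume "degree p = 0"
    then obtain a where a: "p = [:a:]" using degree_eq_zeroE by blast
    with p have "a *s w \<in> W" "a \<noteq> 0" by auto
    from vec.subspace_scale[OF W this(1), of "1 / a"] this(2) \<open>w \<notin> W\<close> show False by simp
  qed
  then have "\<not> constant (poly p)" by (simp add: constant_degree)
  then obtain c where "poly p c = 0" using fundamental_theorem_of_algebra[of p] by metis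
  then obtain q where q: "p = [:- c, 1:] * q" unfolding poly_eq_0_iff_dvd by (elim dvdE)
  have "q \<noteq> 0"
  proof
    assume "q = 0"
    with q have "p = 0" by simp
    with p show False by simp
  qed
  then have "degree p = Suc (degree q)" unfolding q by (subst degree_mult_eq) auto
  with min[of q] \<open>q \<noteq> 0\<close> have "krylov M w q \<notin> W" by auto
  moreover have "M *v krylov M w q - c *s krylov M w q \<in> W"
    using p unfolding q krylov_linear_factor by blast
  ultimately show ?thesis by blast
qed

lemma triangular_flag:
  fixes M :: "complex ^ 'n ^ 'n"
  assumes "k \<le> CARD('n)"
  shows "\<exists>(v :: nat \<Rightarrow> complex ^ 'n) c. inj_on v {..<k} \<and> vec.independent (v ` {..<k}) \<and>
           (\<forall>l<k. M *v v l - c l *s v l \<in> vec.span (v ` {..<l}))"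
  using assms
proof (induction k)
  case 0
  then show ?case by (simp add: vec.independent_empty)
next
  case (Suc k)
  then obtain v :: "nat \<Rightarrow> complex ^ 'n" and c where
    v: "inj_on v {..<k}" "vec.independent (v ` {..<k})"
       "\<And>l. l < k \<Longrightarrow> M *v v l - c l *s v l \<in> vec.span (v ` {..<l})"
    by auto
  have "vec.dim (vec.span (v ` {..<k})) \<le> k"
    using vec.dim_le_card'[of "v ` {..<k}"] card_image_le[of "{..<k}" v] by simp
  then have "vec.span (v ` {..<k}) \<noteq> UNIV"
  proof (rule contrapos_pn)
    assume "vec.span (v ` {..<k}) = UNIV"
    then have "vec.dim (vec.span (v ` {..<k})) = CARD('n)"
      by (simp only: vec_dim_card)
    with Suc.prems show "\<not> vec.dim (vec.span (v ` {..<k})) \<le> k"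
      by linarith
  qed
  then obtain w0 where "w0 \<notin> vec.span (v ` {..<k})" by blast
  from eigenvector_mod_subspace[OF this vec.subspace_span] obtain w a where
    w: "w \<notin> vec.span (v ` {..<k})" "M *v w - a *s w \<in> vec.span (v ` {..<k})" by metis
  let ?v = "v(k := w)" and ?c = "c(k := a)"
  have im: "?v ` {..<l} = v ` {..<l}" if "l \<le> k" for l using that by auto
  have im': "?v ` {..<Suc k} = insert w (v ` {..<k})" by (auto simp: lessThan_Suc)
  have "inj_on ?v {..<Suc k}"
  proof -
    have "w \<notin> v ` {..<k}" using w(1) vec.span_base by metis
    with v(1) show ?thesis
      unfolding inj_on_def by (auto simp: less_Suc_eq)
  qed
  moreover have "vec.independent (?v ` {..<Suc k})"
    unfolding im' using v(2) w(1) by (simp add: vec.independent_insert)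
  moreover have "M *v ?v l - ?c l *s ?v l \<in> vec.span (?v ` {..<l})" if "l < Suc k" for l
    using that v(3)[of l] w(2) im[of l] by (cases "l = k") auto
  ultimately show ?case by blast
qed

text \<open>
  The rows of \<open>Q\<close> are a triangular flag for the transpose of \<open>A\<close>. Since the index type carries no order, an
  injective rank \<open>r\<close> says in which sense \<open>T\<close> is triangular: row \<open>i\<close> involves only indices of rank at
  most \<open>r i\<close>.
\<close>

lemma triangularization:
  fixes A :: "complex ^ 'n ^ 'n"
  obtains Q T :: "complex ^ 'n ^ 'n" and r :: "'n \<Rightarrow> nat" where
    "invertible Q" "Q ** A = T ** Q" "inj r" "\<And>i j. r i < r j \<Longrightarrow> T $ i $ j = 0"
proof -
  let ?q = "CARD('n)" and ?M = "transpose A"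
  obtain v :: "nat \<Rightarrow> complex ^ 'n" and c where
    v: "inj_on v {..<?q}" "vec.independent (v ` {..<?q})"
       "\<And>l. l < ?q \<Longrightarrow> ?M *v v l - c l *s v l \<in> vec.span (v ` {..<l})"
    using triangular_flag[of ?q ?M] by auto
  have "\<exists>u. ?M *v v l = c l *s v l + (\<Sum>j<l. u j *s v j)" if l: "l < ?q" for l
  proof -
    from v(3)[OF l] obtain u where "?M *v v l - c l *s v l = (\<Sum>x\<in>v ` {..<l}. u x *s x)"
      by (auto simp: vec.span_finite)
    also have "\<dots> = (\<Sum>j<l. u (v j) *s v j)"
      using l by (subst sum.reindex) (auto intro: inj_on_subset[OF v(1)])
    finally show ?thesis
      by (intro exI[of _ "u \<circ> v"]) (simp add: algebra_simps)
  qed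
  then obtain u where u: "\<And>l. l < ?q \<Longrightarrow> ?M *v v l = c l *s v l + (\<Sum>j<l. u l j *s v j)"
    by metis
  obtain r :: "'n \<Rightarrow> nat" where r: "bij_betw r UNIV {..<?q}"
    using ex_bij_betw_finite_nat[of "UNIV :: 'n set"] by (auto simp: atLeast0LessThan)
  define Q :: "complex ^ 'n ^ 'n" where "Q = (\<chi> i. v (r i))"
  define T :: "complex ^ 'n ^ 'n" where
    "T = (\<chi> i j. if i = j then c (r i) else if r j < r i then u (r i) (r j) else 0)"
  have injr: "inj r" using r by (simp add: bij_betw_def)
  have rlt: "r i < ?q" for i using r by (auto simp: bij_betw_def)
  have "rows Q = (\<lambda>i. v (r i)) ` UNIV"
    by (auto simp: rows_def row_def Q_def)
  also have "\<dots> = v ` {..<?q}"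
    using r by (auto simp: bij_betw_def image_image[symmetric])
  finally have "rows Q = v ` {..<?q}" .
  moreover have "vec.span (v ` {..<?q}) = UNIV"
  proof -
    have "vec.dim (UNIV :: (complex ^ 'n) set) \<le> card (v ` {..<?q})"
      unfolding vec_dim_card using v(1) by (simp add: card_image)
    from vec.card_ge_dim_independent[OF subset_UNIV v(2) this] show ?thesis by auto
  qed
  ultimately have "invertible Q"
    by (simp add: invertible_left_inverse matrix_left_invertible_span_rows_gen)
  moreover have "Q ** A = T ** Q"
  proof (subst vec_eq_iff, intro allI)
    fix i
    have "(Q ** A) $ i = ?M *v v (r i)"
      by (simp add: vec_eq_iff matrix_matrix_mult_def matrix_vector_mult_def transpose_def Q_def mult.commute)
    also have "\<dots> = c (r i) *s v (r i) + (\<Sum>l<r i. u (r i) l *s v l)"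
      by (rule u[OF rlt])
    also have "(\<Sum>l<r i. u (r i) l *s v l) = (\<Sum>j | r j < r i. u (r i) (r j) *s v (r j))"
    proof (rule sum.reindex_bij_betw[symmetric, of r])
      show "bij_betw r {j. r j < r i} {..<r i}"
        unfolding bij_betw_def
      proof
        show "inj_on r {j. r j < r i}" using injr by (auto simp: inj_on_def)
        show "r ` {j. r j < r i} = {..<r i}"
        proof safe
          fix l assume "l < r i"
          with rlt[of i] r have "l \<in> range r" by (auto simp: bij_betw_def)
          with \<open>l < r i\<close> show "l \<in> r ` {j. r j < r i}" by auto
        qed
      qed
    qed
    also have "c (r i) *s v (r i) + (\<Sum>j | r j < r i. u (r i) (r j) *s v (r j)) =
        (\<Sum>j\<in>insert i {j. r j < r i}. T $ i $ j *s v (r j))"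
      by (subst sum.insert) (auto simp: T_def intro!: sum.cong)
    also have "\<dots> = (\<Sum>j\<in>UNIV. T $ i $ j *s v (r j))"
      by (rule sum.mono_neutral_left) (auto simp: T_def)
    also have "\<dots> = (T ** Q) $ i"
      by (simp add: vec_eq_iff matrix_matrix_mult_def Q_def)
    finally show "(Q ** A) $ i = (T ** Q) $ i" .
  qed
  moreover have "T $ i $ j = 0" if "r i < r j" for i j
    using that by (auto simp: T_def)
  ultimately show ?thesis using injr that by blast
qed

lemma permutes_rank_nonincreasing_id:
  fixes r :: "'n::finite \<Rightarrow> nat"
  assumes "inj r" "p permutes UNIV" "\<And>i. r (p i) \<le> r i"
  shows "p = id"
proof
  fix i
  have "(\<Sum>i\<in>UNIV. r (p i)) = (\<Sum>i\<in>UNIV. r i)"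
    by (rule sum.permute[OF assms(2), symmetric, unfolded o_def])
  then have "r (p i) = r i"
    using assms(3) sum_strict_mono_ex1[of UNIV "\<lambda>i. r (p i)" r]
    by (metis UNIV_I finite less_irrefl order.not_eq_order_implies_strict)
  then show "p i = id i" using assms(1) by (simp add: inj_eq)
qed

lemma det_triangular_rank:
  fixes T :: "'a::comm_ring_1 ^ 'n ^ 'n"
  assumes "inj r" and T: "\<And>i j. (r i :: nat) < r j \<Longrightarrow> T $ i $ j = 0"
  shows "det T = (\<Prod>i\<in>UNIV. T $ i $ i)"
proof -
  let ?t = "\<lambda>p. of_int (sign p) * (\<Prod>i\<in>UNIV. T $ i $ p i)"
  have "?t p = 0" if p: "p \<in> {p. p permutes UNIV} - {id}" for p
  proof -
    have "\<exists>i. r i < r (p i)"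
      using permutes_rank_nonincreasing_id[OF assms(1), of p] p by (metis DiffD1 DiffD2 mem_Collect_eq not_less singleton_iff)
    then have "(\<Prod>i\<in>UNIV. T $ i $ p i) = 0"
      using T by (intro prod_zero) auto
    then show ?thesis by simp
  qed
  then have "(\<Sum>p | p permutes UNIV. ?t p) = (\<Sum>p\<in>{id}. ?t p)"
    by (intro sum.mono_neutral_right) (auto simp: permutes_id finite_permutations)
  then show ?thesis by (simp add: det_def sign_id)
qed

lemma charpoly_triangularization:
  fixes A Q T :: "complex ^ 'n ^ 'n"
  assumes "invertible Q" "Q ** A = T ** Q" "inj r"
    and T: "\<And>i j. (r i :: nat) < r j \<Longrightarrow> T $ i $ j = 0"
  shows "charpoly A = (\<Prod>i\<in>UNIV. [:- T $ i $ i, 1:])"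
proof -
  define cm :: "complex ^ 'n ^ 'n \<Rightarrow> complex poly ^ 'n ^ 'n" where "cm B = (\<chi> i j. [:B $ i $ j:])" for B
  let ?X = "mat [:0, 1:] :: complex poly ^ 'n ^ 'n"
  have const_sum: "(\<Sum>k\<in>I. [:g k:]) = [:\<Sum>k\<in>I. g k:]" for g :: "'n \<Rightarrow> complex" and I
    by (induction I rule: infinite_finite_induct) auto
  have cm_mult: "cm B ** cm C = cm (B ** C)" for B C
    by (simp add: vec_eq_iff cm_def matrix_matrix_mult_def const_sum mult.commute)
  have matrix_diff_ldistrib: "B ** (C - D) = B ** C - B ** D"
    and matrix_diff_rdistrib: "(C - D) ** B = C ** B - D ** B" for B C D :: "complex poly ^ 'n ^ 'n"
    by (simp_all add: vec_eq_iff matrix_matrix_mult_def algebra_simps sum_subtractf)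
  have X_comm: "B ** ?X = ?X ** B" for B :: "complex poly ^ 'n ^ 'n"
    by (simp add: vec_eq_iff matrix_matrix_mult_def mat_def if_distrib if_distribR
        sum.delta sum.delta' mult.commute cong: if_cong)
  have "cm Q ** (?X - cm A) = (?X - cm T) ** cm Q"
    using assms(2) by (simp add: matrix_diff_ldistrib matrix_diff_rdistrib cm_mult X_comm)
  then have eq: "det (cm Q) * det (?X - cm A) = det (?X - cm T) * det (cm Q)"
    by (metis det_mul)
  obtain P where "Q ** P = mat 1" using assms(1) by (auto simp: invertible_def)
  moreover have "cm (mat 1) = mat 1"
    by (simp add: vec_eq_iff cm_def mat_def one_pCons)
  ultimately have "det (cm Q) * det (cm P) = 1"
    by (metis cm_mult det_mul det_I)
  then have "det (cm Q) \<noteq> 0" by auto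
  with eq have "det (?X - cm A) = det (?X - cm T)" by simp
  also have "\<dots> = (\<Prod>i\<in>UNIV. (?X - cm T) $ i $ i)"
    using T by (intro det_triangular_rank[OF assms(3)]) (auto simp: cm_def mat_def)
  also have "\<dots> = (\<Prod>i\<in>UNIV. [:- T $ i $ i, 1:])"
    by (intro prod.cong) (auto simp: cm_def mat_def)
  finally show ?thesis by (simp add: charpoly_def cm_def)
qed

lemma norm_prod_roots_outside:
  fixes a :: "'i \<Rightarrow> complex"
  assumes "finite I"
  shows "cmod (\<Prod>z\<in>#filter_mset (\<lambda>z. cmod z > 1) (proots (\<Prod>i\<in>I. [:- a i, 1:])). z) =
    (\<Prod>i\<in>I. max 1 (cmod (a i)))"
proof -
  have "proots (\<Prod>i\<in>I. [:- a i, 1:]) = (\<Sum>i\<in>I. {#a i#})"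
    by (subst proots_prod) auto
  moreover have "cmod (\<Prod>z\<in>#filter_mset (\<lambda>z. cmod z > 1) (\<Sum>i\<in>I. {#a i#}). z) =
    (\<Prod>i\<in>I. max 1 (cmod (a i)))"
    using assms by (induction I rule: finite_induct) (auto simp: norm_mult max_def)
  ultimately show ?thesis by simp
qed

section \<open>Covers by sets of close points, and one complex coordinate\<close>

text \<open>
  \<open>P\<close> is covered by at most \<open>N\<close> sets, any two members of the same set being related by \<open>E\<close>. In
  applications \<open>E\<close> means being close at all times, so that a set none of whose distinct members are
  related by \<open>E\<close> has at most \<open>N\<close> elements.
\<close>

definition covered :: "real \<Rightarrow> ('a \<Rightarrow> 'a \<Rightarrow> bool) \<Rightarrow> 'a set \<Rightarrow> bool" where
  "covered N E P \<longleftrightarrow> (\<exists>F. finite F \<and> real (card F) \<le> N \<and> P \<subseteq> \<Union>F \<and>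
     (\<forall>B\<in>F. \<forall>x\<in>B. \<forall>y\<in>B. E x y))"

lemma covered_mono:
  assumes "covered N E P" "N \<le> N'" "\<And>x y. x \<in> P \<Longrightarrow> y \<in> P \<Longrightarrow> E x y \<Longrightarrow> E' x y"
  shows "covered N' E' P"
proof -
  from assms(1) obtain F where F: "finite F" "real (card F) \<le> N" "P \<subseteq> \<Union>F"
    "\<forall>B\<in>F. \<forall>x\<in>B. \<forall>y\<in>B. E x y" by (auto simp: covered_def)
  have "real (card ((\<lambda>B. B \<inter> P) ` F)) \<le> N'"
    using card_image_le[OF F(1), of "\<lambda>B. B \<inter> P"] F(2) assms(2) by linarith
  then show ?thesis
    unfolding covered_def using F assms(3)
    by (intro exI[of _ "(\<lambda>B. B \<inter> P) ` F"]) fastforce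
qed

lemma covered_trivial:
  assumes "\<And>x y. x \<in> P \<Longrightarrow> y \<in> P \<Longrightarrow> E x y"
  shows "covered 1 E P"
  unfolding covered_def using assms by (intro exI[of _ "{P}"]) auto

lemma covered_fibres:
  assumes "finite I" "real (card I) \<le> N" "h ` P \<subseteq> I"
    and "\<And>x y. x \<in> P \<Longrightarrow> y \<in> P \<Longrightarrow> h x = h y \<Longrightarrow> E x y"
  shows "covered N E P"
proof -
  let ?F = "(\<lambda>c. {x \<in> P. h x = c}) ` I"
  have "real (card ?F) \<le> N"
    using card_image_le[OF assms(1), of "\<lambda>c. {x \<in> P. h x = c}"] assms(2) by linarith
  then show ?thesis
    unfolding covered_def using assms by (intro exI[of _ ?F]) auto
qed

lemma covered_refine:
  assumes "covered N E P" "0 \<le> K"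
    and "\<And>P'. P' \<subseteq> P \<Longrightarrow> (\<And>x y. x \<in> P' \<Longrightarrow> y \<in> P' \<Longrightarrow> E x y) \<Longrightarrow> covered K E' P'"
  shows "covered (N * K) E' P"
proof -
  from assms(1) obtain F where F: "finite F" "real (card F) \<le> N" "P \<subseteq> \<Union>F"
    "\<forall>B\<in>F. \<forall>x\<in>B. \<forall>y\<in>B. E x y" by (auto simp: covered_def)
  have "\<exists>G. finite G \<and> real (card G) \<le> K \<and> B \<inter> P \<subseteq> \<Union>G \<and> (\<forall>B'\<in>G. \<forall>x\<in>B'. \<forall>y\<in>B'. E' x y)"
    if "B \<in> F" for B
    using assms(3)[of "B \<inter> P"] F(4) that unfolding covered_def by auto
  then obtain G where G: "\<And>B. B \<in> F \<Longrightarrow> finite (G B) \<and> real (card (G B)) \<le> K \<and>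
      B \<inter> P \<subseteq> \<Union>(G B) \<and> (\<forall>B'\<in>G B. \<forall>x\<in>B'. \<forall>y\<in>B'. E' x y)" by metis
  have "real (card (\<Union>B\<in>F. G B)) \<le> (\<Sum>B\<in>F. real (card (G B)))"
    using card_UN_le[OF F(1), of G] by (metis of_nat_le_iff of_nat_sum)
  also have "\<dots> \<le> real (card F) * K"
    using G by (intro sum_bounded_above) auto
  also have "\<dots> \<le> N * K"
    using F(2) assms(2) by (rule mult_right_mono)
  finally have "real (card (\<Union>B\<in>F. G B)) \<le> N * K" .
  moreover have "P \<subseteq> \<Union>(\<Union>B\<in>F. G B)"
  proof
    fix x assume "x \<in> P"
    with F(3) obtain B where "B \<in> F" "x \<in> B" by blast
    with G[of B] \<open>x \<in> P\<close> show "x \<in> \<Union>(\<Union>B\<in>F. G B)" by blast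
  qed
  ultimately show ?thesis
    unfolding covered_def using F(1) G
    by (intro exI[of _ "\<Union>B\<in>F. G B"]) blast
qed

lemma card_separated_le_covered:
  assumes "covered N E P" "S \<subseteq> P" "\<And>x y. x \<in> S \<Longrightarrow> y \<in> S \<Longrightarrow> E x y \<Longrightarrow> x = y"
  shows "finite S \<and> real (card S) \<le> N"
proof -
  from assms(1) obtain F where F: "finite F" "real (card F) \<le> N" "P \<subseteq> \<Union>F"
    "\<forall>B\<in>F. \<forall>x\<in>B. \<forall>y\<in>B. E x y" by (auto simp: covered_def)
  have "\<forall>x\<in>S. \<exists>B\<in>F. x \<in> B" using F(3) assms(2) by blast
  then obtain b where b: "\<And>x. x \<in> S \<Longrightarrow> b x \<in> F \<and> x \<in> b x" by metis
  have inj: "inj_on b S"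
    unfolding inj_on_def using assms(3) F(4) b by metis
  have sub: "b ` S \<subseteq> F" using b by auto
  have "finite S" using inj_on_finite[OF inj sub F(1)] .
  moreover have "card S \<le> card F" using card_inj_on_le[OF inj sub F(1)] .
  ultimately show ?thesis using F(2) by simp
qed

lemma covered_squares:
  fixes z :: "'a \<Rightarrow> complex"
  assumes "0 < s" "0 \<le> a" "\<And>x y. x \<in> P \<Longrightarrow> y \<in> P \<Longrightarrow> cmod (z x - z y) \<le> a * s"
  shows "covered ((2 * a + 2)\<^sup>2) (\<lambda>x y. cmod (z x - z y) \<le> 2 * s) P"
proof (cases "P = {}")
  case True
  then show ?thesis unfolding covered_def by (intro exI[of _ "{}"]) simp
next
  case False
  then obtain w where w: "w \<in> P" by auto
  let ?u = "\<lambda>x. (z x - z w) / s"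
  let ?h = "\<lambda>x. (\<lfloor>Re (?u x)\<rfloor>, \<lfloor>Im (?u x)\<rfloor>)"
  let ?I = "{\<lfloor>- a\<rfloor>..\<lfloor>a\<rfloor>}"
  show ?thesis
  proof (rule covered_fibres[where h = ?h and I = "?I \<times> ?I"])
    have "real (card ?I) \<le> 2 * a + 2"
      using assms(2) by simp linarith
    then have "real (card ?I) * real (card ?I) \<le> (2 * a + 2) * (2 * a + 2)"
      using assms(2) by (intro mult_mono) auto
    then show "real (card (?I \<times> ?I)) \<le> (2 * a + 2)\<^sup>2"
      by (simp only: card_cartesian_product of_nat_mult power2_eq_square)
    show "?h ` P \<subseteq> ?I \<times> ?I"
    proof (intro image_subsetI)
      fix x assume "x \<in> P"
      then have "cmod (?u x) \<le> a"
        using assms(1) assms(3)[OF _ w, of x] by (simp add: norm_divide field_simps)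
      then have "\<bar>Re (?u x)\<bar> \<le> a" "\<bar>Im (?u x)\<bar> \<le> a"
        using abs_Re_le_cmod[of "?u x"] abs_Im_le_cmod[of "?u x"] by linarith+
      then have "- a \<le> Re (?u x)" "Re (?u x) \<le> a" "- a \<le> Im (?u x)" "Im (?u x) \<le> a"
        by linarith+
      from this[THEN floor_mono] show "?h x \<in> ?I \<times> ?I"
        by (simp only: mem_Times_iff fst_conv snd_conv atLeastAtMost_iff)
    qed
    show "cmod (z x - z y) \<le> 2 * s" if "?h x = ?h y" for x y
    proof -
      from that have "\<bar>Re (?u x - ?u y)\<bar> \<le> 1" "\<bar>Im (?u x - ?u y)\<bar> \<le> 1"
        by (simp, linarith)+
      then have "cmod (?u x - ?u y) \<le> 2"
        using cmod_le[of "?u x - ?u y"] by linarith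
      moreover have "?u x - ?u y = (z x - z y) / s" by (simp add: diff_divide_distrib)
      ultimately show ?thesis using assms(1) by (simp add: norm_divide field_simps)
    qed
  qed auto
qed

lemma scalar_recursion_bound:
  fixes d :: "nat \<Rightarrow> complex"
  assumes "\<And>i. i < t \<Longrightarrow> cmod (d (Suc (s + i)) - c * d (s + i)) \<le> B"
    and "cmod (d s) \<le> \<rho>" "0 \<le> B"
  shows "cmod (d (s + t)) \<le> max 1 (cmod c) ^ t * (\<rho> + t * B)"
  using assms(1)
proof (induction t)
  case 0
  then show ?case using assms(2) by simp
next
  case (Suc t)
  let ?L = "max 1 (cmod c)"
  have \<rho>: "0 \<le> \<rho>" using assms(2) norm_ge_zero order_trans by blast
  have "cmod (d (s + Suc t)) \<le> cmod c * cmod (d (s + t)) + B"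
    using Suc.prems[of t] norm_triangle_ineq2[of "d (Suc (s + t))" "c * d (s + t)"]
    by (simp add: norm_mult)
  also have "\<dots> \<le> ?L * (?L ^ t * (\<rho> + t * B)) + B"
    using Suc by (intro add_right_mono mult_mono) auto
  also have "\<dots> \<le> ?L * (?L ^ t * (\<rho> + t * B)) + ?L ^ Suc t * B"
    using assms(3) mult_right_mono[of 1 "?L ^ Suc t" B] one_le_power[of ?L "Suc t"] by simp
  also have "\<dots> = ?L ^ Suc t * (\<rho> + Suc t * B)"
    by (simp add: algebra_simps)
  finally show ?case .
qed

text \<open>
  Two sequences whose difference follows \<open>d\<^sub>i\<^sub>+\<^sub>1 = c d\<^sub>i + O(B)\<close> and which are \<open>\<rho>\<close>-close at time \<open>j m\<close> are
  \<open>2 L\<^sup>m \<rho>\<close>-close up to time \<open>(j + 1) m\<close>; squares of side \<open>\<rho> / 2\<close> at that time then restore \<open>\<rho>\<close>-closeness.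
\<close>

lemma scalar_cover_blocks:
  fixes g :: "'a \<Rightarrow> nat \<Rightarrow> complex" and c :: complex
  defines "L \<equiv> max 1 (cmod c)"
  assumes "0 \<le> B" and \<rho>: "\<rho> = m * B + 1"
    and "\<And>x y. x \<in> P \<Longrightarrow> y \<in> P \<Longrightarrow> g x 0 = g y 0"
    and "\<And>x y i. x \<in> P \<Longrightarrow> y \<in> P \<Longrightarrow>
      cmod ((g x (Suc i) - g y (Suc i)) - c * (g x i - g y i)) \<le> B"
  shows "covered (((10 * L ^ m)\<^sup>2) ^ j)
    (\<lambda>x y. (\<forall>i\<le>j * m. cmod (g x i - g y i) \<le> 2 * L ^ m * \<rho>) \<and>
       cmod (g x (j * m) - g y (j * m)) \<le> \<rho>) P"
proof (induction j)
  have L1: "1 \<le> L" by (simp add: L_def)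
  then have Lm: "1 \<le> L ^ m" by simp
  have \<rho>0: "0 < \<rho>" using assms(2) by (simp add: \<rho> add_nonneg_pos)
  {
    case 0
    show ?case
    proof -
      have "covered 1 (\<lambda>x y. (\<forall>i\<le>0 * m. cmod (g x i - g y i) \<le> 2 * L ^ m * \<rho>) \<and>
          cmod (g x (0 * m) - g y (0 * m)) \<le> \<rho>) P"
      proof (rule covered_trivial)
        fix x y assume "x \<in> P" "y \<in> P"
        from assms(4)[OF this] show "(\<forall>i\<le>0 * m. cmod (g x i - g y i) \<le> 2 * L ^ m * \<rho>) \<and>
          cmod (g x (0 * m) - g y (0 * m)) \<le> \<rho>"
          using \<rho>0 Lm by simp
      qed
      then show ?thesis by simp
    qed
  next
    case (Suc j)
    have "covered (((10 * L ^ m)\<^sup>2) ^ j * (10 * L ^ m)\<^sup>2)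
      (\<lambda>x y. (\<forall>i\<le>Suc j * m. cmod (g x i - g y i) \<le> 2 * L ^ m * \<rho>) \<and>
        cmod (g x (Suc j * m) - g y (Suc j * m)) \<le> \<rho>) P"
    proof (rule covered_refine[OF Suc])
      fix P' assume P': "P' \<subseteq> P"
        and E: "\<And>x y. x \<in> P' \<Longrightarrow> y \<in> P' \<Longrightarrow>
          (\<forall>i\<le>j * m. cmod (g x i - g y i) \<le> 2 * L ^ m * \<rho>) \<and>
          cmod (g x (j * m) - g y (j * m)) \<le> \<rho>"
      have block: "cmod (g x (j * m + t) - g y (j * m + t)) \<le> 2 * L ^ m * \<rho>"
        if x: "x \<in> P'" "y \<in> P'" and t: "t \<le> m" for x y t
      proof -
        have "cmod (g x (j * m + t) - g y (j * m + t)) \<le> L ^ t * (\<rho> + t * B)"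
          unfolding L_def using x P' assms(2,5) E
          by (intro scalar_recursion_bound[where d = "\<lambda>i. g x i - g y i"]) blast+
        also have "\<dots> \<le> L ^ m * (\<rho> + \<rho>)"
        proof (intro mult_mono add_mono order_refl)
          show "L ^ t \<le> L ^ m" using L1 t by (rule power_increasing[rotated])
          have "t * B \<le> m * B" using t assms(2) by (intro mult_right_mono) auto
          then show "t * B \<le> \<rho>" by (simp add: \<rho>)
        qed (use Lm \<rho>0 assms(2) in auto)
        finally show ?thesis by (simp add: algebra_simps)
      qed
      have "covered ((2 * (4 * L ^ m) + 2)\<^sup>2)
          (\<lambda>x y. cmod (g x (Suc j * m) - g y (Suc j * m)) \<le> 2 * (\<rho> / 2)) P'"
      proof (rule covered_squares)
        fix x y assume "x \<in> P'" "y \<in> P'"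
        from block[OF this order_refl]
        show "cmod (g x (Suc j * m) - g y (Suc j * m)) \<le> 4 * L ^ m * (\<rho> / 2)"
          by (simp add: ac_simps)
      qed (use \<rho>0 Lm in auto)
      then show "covered ((10 * L ^ m)\<^sup>2)
         (\<lambda>x y. (\<forall>i\<le>Suc j * m. cmod (g x i - g y i) \<le> 2 * L ^ m * \<rho>) \<and>
            cmod (g x (Suc j * m) - g y (Suc j * m)) \<le> \<rho>) P'"
      proof (rule covered_mono)
        show "(2 * (4 * L ^ m) + 2)\<^sup>2 \<le> (10 * L ^ m)\<^sup>2"
          using Lm by (intro power_mono) auto
        fix x y assume xy: "x \<in> P'" "y \<in> P'"
          and *: "cmod (g x (Suc j * m) - g y (Suc j * m)) \<le> 2 * (\<rho> / 2)"
        have "cmod (g x i - g y i) \<le> 2 * L ^ m * \<rho>" if "i \<le> Suc j * m" for i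
        proof (cases "i \<le> j * m")
          case True
          with E xy show ?thesis by blast
        next
          case False
          then have "i = j * m + (i - j * m)" "i - j * m \<le> m" using that by auto
          then show ?thesis using block[OF xy] by metis
        qed
        with * show "(\<forall>i\<le>Suc j * m. cmod (g x i - g y i) \<le> 2 * L ^ m * \<rho>) \<and>
            cmod (g x (Suc j * m) - g y (Suc j * m)) \<le> \<rho>" by simp
      qed
    qed auto
    then show ?case by (simp only: power_Suc mult.commute)
  }
qed

text \<open>
  The factor \<open>100\<close> lost in each block of \<open>m\<close> steps costs \<open>ln 100 / m \<le> \<epsilon>\<close> in the exponential rate. The
  points of \<open>P\<close> are arbitrary; only the differences of their coordinates \<open>g\<close> matter.
\<close>

lemma scalar_cover:
  fixes c :: complex
  assumes "0 \<le> B" "0 < \<epsilon>"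
  shows "\<exists>R C. 0 < C \<and> (\<forall>(n::nat) P (g :: 'a \<Rightarrow> nat \<Rightarrow> complex).
    (\<forall>x\<in>P. \<forall>y\<in>P. g x 0 = g y 0 \<and>
      (\<forall>i<n. cmod ((g x (Suc i) - g y (Suc i)) - c * (g x i - g y i)) \<le> B)) \<longrightarrow>
    covered (C * exp (n * (2 * ln (max 1 (cmod c)) + \<epsilon>)))
      (\<lambda>x y. \<forall>i\<le>n. cmod (g x i - g y i) \<le> R) P)"
proof -
  define L where "L = max 1 (cmod c)"
  define m where "m = Suc (nat \<lceil>ln 100 / \<epsilon>\<rceil>)"
  define K where "K = (10 * L ^ m)\<^sup>2"
  define \<rho> where "\<rho> = m * B + 1"
  have L1: "1 \<le> L" by (simp add: L_def)
  have K0: "0 < K" using L1 by (simp add: K_def)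
  have "ln 100 / \<epsilon> \<le> m" unfolding m_def by linarith
  then have m: "ln 100 \<le> m * \<epsilon>" using assms(2) by (simp add: field_simps)
  have lnK: "ln K = ln 100 + 2 * m * ln L"
    using L1 by (simp add: K_def power_mult_distrib ln_mult ln_realpow flip: power_mult)
  have main: "covered (K * exp (n * (2 * ln L + \<epsilon>))) (\<lambda>x y. \<forall>i\<le>n. cmod (g x i - g y i) \<le> 2 * L ^ m * \<rho>) P"
    if hyp: "\<forall>x\<in>P. \<forall>y\<in>P. g x 0 = g y 0 \<and>
      (\<forall>i<n. cmod ((g x (Suc i) - g y (Suc i)) - c * (g x i - g y i)) \<le> B)"
    for n :: nat and P and g :: "'a \<Rightarrow> nat \<Rightarrow> complex"
  proof -
    \<comment> \<open>The recursion is continued without error beyond time \<open>n\<close>, so that whole blocks can be used.\<close>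
    define g' where "g' x i = (if i \<le> n then g x i else c ^ (i - n) * g x n)" for x i
    have rec: "cmod ((g' x (Suc i) - g' y (Suc i)) - c * (g' x i - g' y i)) \<le> B"
      if "x \<in> P" "y \<in> P" for x y i
    proof (cases "i < n")
      case True
      with hyp that show ?thesis by (simp add: g'_def)
    next
      case False
      then have "g' x (Suc i) = c * g' x i" for x
        by (cases "i = n") (simp_all add: g'_def Suc_diff_le)
      then show ?thesis using assms(1) by (simp add: algebra_simps)
    qed
    have "covered (K ^ Suc (n div m)) (\<lambda>x y. (\<forall>i\<le>Suc (n div m) * m. cmod (g' x i - g' y i) \<le> 2 * L ^ m * \<rho>) \<and>
       cmod (g' x (Suc (n div m) * m) - g' y (Suc (n div m) * m)) \<le> \<rho>) P"
      unfolding K_def L_def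
    proof (rule scalar_cover_blocks[where g = g', OF assms(1) \<rho>_def _ rec])
      fix x y assume "x \<in> P" "y \<in> P"
      with hyp have "g x 0 = g y 0" by blast
      then show "g' x 0 = g' y 0" unfolding g'_def by simp
    qed
    then show ?thesis
    proof (rule covered_mono)
      have "n div m * ln K \<le> n / m * ln K"
        using L1 by (intro mult_right_mono of_nat_div_le_of_nat) (simp add: lnK)
      also have "\<dots> = n / m * ln 100 + n * (2 * ln L)"
        by (simp add: lnK m_def field_simps)
      also have "\<dots> \<le> n / m * (m * \<epsilon>) + n * (2 * ln L)"
        using m by (intro add_right_mono mult_left_mono) auto
      also have "\<dots> = n * (2 * ln L + \<epsilon>)" by (simp add: m_def field_simps)
      finally have "exp (n div m * ln K) \<le> exp (n * (2 * ln L + \<epsilon>))" by simp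
      then have "K ^ (n div m) \<le> exp (n * (2 * ln L + \<epsilon>))"
        using K0 by (simp add: exp_of_nat_mult)
      then show "K ^ Suc (n div m) \<le> K * exp (n * (2 * ln L + \<epsilon>))"
        using K0 by simp
      fix x y
      assume *: "(\<forall>i\<le>Suc (n div m) * m. cmod (g' x i - g' y i) \<le> 2 * L ^ m * \<rho>) \<and>
       cmod (g' x (Suc (n div m) * m) - g' y (Suc (n div m) * m)) \<le> \<rho>"
      have "n \<le> Suc (n div m) * m"
        using dividend_less_div_times[of m n] by (simp add: m_def)
      with * have "\<forall>i\<le>n. cmod (g' x i - g' y i) \<le> 2 * L ^ m * \<rho>" by auto
      then show "\<forall>i\<le>n. cmod (g x i - g y i) \<le> 2 * L ^ m * \<rho>" by (simp add: g'_def)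
    qed
  qed
  show ?thesis
    by (intro exI[of _ "2 * L ^ m * \<rho>"] exI[of _ K] conjI K0 allI impI,
        fold L_def, rule main, assumption)
qed

section \<open>Covering the pseudoorbits of a complex linear map\<close>

lemma complex_matrix_bound:
  fixes Q :: "complex ^ 'n ^ 'm"
  obtains b where "0 < b" "\<And>z. norm (Q *v z) \<le> b * norm z"
proof -
  obtain K where "0 < K" "\<And>z. norm (Q *v z) \<le> norm z * K"
    using bounded_linear.pos_bounded[OF matrix_vector_mul_bounded_linear[of Q]] by blast
  then show ?thesis using that[of K] by (simp add: mult.commute)
qed

text \<open>
  Pseudoorbits of \<open>z \<mapsto> A z\<close> as infinite sequences, of which only the entries up to \<open>n\<close> are constrained.
\<close>

definition error_orbits :: "complex ^ 'n ^ 'n \<Rightarrow> nat \<Rightarrow> real \<Rightarrow> complex ^ 'n \<Rightarrow> (nat \<Rightarrow> complex ^ 'n) set"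
  where "error_orbits A n \<delta> z0 = {x. x 0 = z0 \<and> (\<forall>t<n. norm (x (Suc t) - A *v x t) \<le> \<delta>)}"

text \<open>
  If the coordinates of smaller rank of two pseudoorbits are \<open>R\<close>-close, then the difference of their \<open>i\<close>-th
  coordinates follows the scalar recursion with multiplier \<open>T\<^sub>i\<^sub>i\<close> up to a bounded error.
\<close>

lemma triangular_cover_step:
  fixes A Q T :: "complex ^ 'n ^ 'n"
  assumes QA: "Q ** A = T ** Q"
    and T: "\<And>j. r i < (r j :: nat) \<Longrightarrow> T $ i $ j = 0" and "inj r"
    and b: "0 < b" "\<And>z. norm (Q *v z) \<le> b * norm z"
    and xy: "x \<in> error_orbits A n \<delta> z0" "y \<in> error_orbits A n \<delta> z0"
    and close: "\<And>j t. r j < r i \<Longrightarrow> t \<le> n \<Longrightarrow> cmod ((Q *v x t) $ j - (Q *v y t) $ j) \<le> R"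
    and t: "t < n"
  shows "cmod (((Q *v x (Suc t)) $ i - (Q *v y (Suc t)) $ i) -
    T $ i $ i * ((Q *v x t) $ i - (Q *v y t) $ i)) \<le> 2 * b * \<delta> + (\<Sum>j\<in>UNIV. cmod (T $ i $ j)) * \<bar>R\<bar>"
proof -
  define e where "e z = z (Suc t) - A *v z t" for z :: "nat \<Rightarrow> complex ^ 'n"
  define w where "w = Q *v x t - Q *v y t"
  have step: "Q *v z (Suc t) = T *v (Q *v z t) + Q *v e z" for z
    by (simp add: e_def matrix_vector_mult_diff_distrib matrix_vector_mul_assoc QA)
  have "(Q *v x (Suc t)) $ i - (Q *v y (Suc t)) $ i = (T *v w) $ i + (Q *v e x) $ i - (Q *v e y) $ i"
    by (simp add: step w_def matrix_vector_mult_diff_distrib)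
  also have "(T *v w) $ i = T $ i $ i * w $ i + (\<Sum>j\<in>UNIV - {i}. T $ i $ j * w $ j)"
    by (simp add: matrix_vector_mult_def sum.remove)
  finally have "((Q *v x (Suc t)) $ i - (Q *v y (Suc t)) $ i) - T $ i $ i * w $ i =
      (\<Sum>j\<in>UNIV - {i}. T $ i $ j * w $ j) + ((Q *v e x) $ i - (Q *v e y) $ i)" by simp
  moreover have "cmod (\<Sum>j\<in>UNIV - {i}. T $ i $ j * w $ j) \<le> (\<Sum>j\<in>UNIV - {i}. cmod (T $ i $ j) * \<bar>R\<bar>)"
  proof (rule sum_norm_le)
    fix j assume j: "j \<in> UNIV - {i}"
    show "cmod (T $ i $ j * w $ j) \<le> cmod (T $ i $ j) * \<bar>R\<bar>"
    proof (cases "r j < r i")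
      case True
      with close[OF this, of t] t have "cmod (w $ j) \<le> \<bar>R\<bar>" by (simp add: w_def)
      then show ?thesis by (simp add: norm_mult mult_left_mono)
    next
      case False
      with j \<open>inj r\<close> have "r i < r j" by (metis DiffD2 injD insertI1 linorder_neqE_nat)
      then show ?thesis by (simp add: T)
    qed
  qed
  moreover have "(\<Sum>j\<in>UNIV - {i}. cmod (T $ i $ j) * \<bar>R\<bar>) \<le> (\<Sum>j\<in>UNIV. cmod (T $ i $ j)) * \<bar>R\<bar>"
    unfolding sum_distrib_right by (rule sum_mono2) auto
  moreover have "cmod ((Q *v e z) $ i) \<le> b * \<delta>" if "z \<in> error_orbits A n \<delta> z0" for z
  proof -
    have "norm (e z) \<le> \<delta>" using that t by (simp add: error_orbits_def e_def)
    then have "b * norm (e z) \<le> b * \<delta>" using b(1) by simp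
    with b(2)[of "e z"] Finite_Cartesian_Product.norm_nth_le[of "Q *v e z" i] show ?thesis by linarith
  qed
  from this[OF xy(1)] this[OF xy(2)]
  have "cmod ((Q *v e x) $ i - (Q *v e y) $ i) \<le> 2 * b * \<delta>"
    using norm_triangle_ineq4[of "(Q *v e x) $ i" "(Q *v e y) $ i"] by linarith
  ultimately show ?thesis
    using norm_triangle_ineq[of "\<Sum>j\<in>UNIV - {i}. T $ i $ j * w $ j" "(Q *v e x) $ i - (Q *v e y) $ i"]
    by (simp add: w_def)
qed

text \<open>
  By induction on \<open>k\<close>: each new coordinate refines the classes found for the previous ones.
\<close>

lemma triangular_cover:
  fixes A Q T :: "complex ^ 'n ^ 'n"
  assumes QA: "Q ** A = T ** Q"
    and T: "\<And>i j. r i < (r j :: nat) \<Longrightarrow> T $ i $ j = 0" and "inj r"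
    and "0 < \<epsilon>" "0 \<le> \<delta>"
  shows "\<exists>R C. 0 < C \<and> (\<forall>n. covered
    (C * exp (n * (\<Sum>i | r i < k. 2 * ln (max 1 (cmod (T $ i $ i))) + \<epsilon>)))
    (\<lambda>x y. \<forall>i t. r i < k \<longrightarrow> t \<le> n \<longrightarrow> cmod ((Q *v x t) $ i - (Q *v y t) $ i) \<le> R)
    (error_orbits A n \<delta> z0))"
proof (induction k)
  case 0
  then show ?case
    by (intro exI[of _ 1] exI[of _ "1 :: real"]) (auto intro: covered_trivial)
next
  case (Suc k)
  let ?h = "\<lambda>i. 2 * ln (max 1 (cmod (T $ i $ i))) + \<epsilon>"
  let ?\<phi> = "\<lambda>i (x :: nat \<Rightarrow> complex ^ 'n) t. (Q *v x t) $ i"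
  from Suc obtain R C where C: "0 < C" and cov: "\<And>n. covered (C * exp (real n * (\<Sum>i | r i < k. ?h i)))
    (\<lambda>x y. \<forall>i t. r i < k \<longrightarrow> t \<le> n \<longrightarrow> cmod (?\<phi> i x t - ?\<phi> i y t) \<le> R) (error_orbits A n \<delta> z0)"
    by blast
  show ?case
  proof (cases "\<exists>i. r i = k")
    case False
    then have "r i < Suc k \<longleftrightarrow> r i < k" for i by (auto simp: less_Suc_eq)
    with C cov show ?thesis by auto
  next
    case True
    then obtain i where i: "r i = k" by blast
    have less: "r j < Suc k \<longleftrightarrow> j = i \<or> r j < k" for j
      using i \<open>inj r\<close> by (auto simp: less_Suc_eq inj_eq)
    obtain b where b: "0 < b" "\<And>z. norm (Q *v z) \<le> b * norm z"
      using complex_matrix_bound[of Q] by blast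
    define B where "B = 2 * b * \<delta> + (\<Sum>j\<in>UNIV. cmod (T $ i $ j)) * \<bar>R\<bar>"
    have "0 \<le> B" using b(1) \<open>0 \<le> \<delta>\<close> by (auto simp: B_def intro!: add_nonneg_nonneg mult_nonneg_nonneg sum_nonneg)
    from scalar_cover[OF this \<open>0 < \<epsilon>\<close>, where c = "T $ i $ i" and 'a = "nat \<Rightarrow> complex ^ 'n"]
    obtain R' C' where C': "0 < C'" and scov: "\<And>(n::nat) P (g :: (nat \<Rightarrow> complex ^ 'n) \<Rightarrow> nat \<Rightarrow> complex).
      \<forall>x\<in>P. \<forall>y\<in>P. g x 0 = g y 0 \<and>
       (\<forall>t<n. cmod ((g x (Suc t) - g y (Suc t)) - T $ i $ i * (g x t - g y t)) \<le> B) \<Longrightarrow>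
      covered (C' * exp (real n * ?h i)) (\<lambda>x y. \<forall>t\<le>n. cmod (g x t - g y t) \<le> R') P"
      by blast
    have "covered ((C * C') * exp (real n * (\<Sum>i | r i < Suc k. ?h i)))
      (\<lambda>x y. \<forall>j t. r j < Suc k \<longrightarrow> t \<le> n \<longrightarrow> cmod (?\<phi> j x t - ?\<phi> j y t) \<le> max R R')
      (error_orbits A n \<delta> z0)" for n
    proof -
      have "covered (C * exp (real n * (\<Sum>i | r i < k. ?h i)) * (C' * exp (real n * ?h i)))
        (\<lambda>x y. \<forall>j t. r j < Suc k \<longrightarrow> t \<le> n \<longrightarrow> cmod (?\<phi> j x t - ?\<phi> j y t) \<le> max R R')
        (error_orbits A n \<delta> z0)"
      proof (rule covered_refine[OF cov])
        fix P assume P: "P \<subseteq> error_orbits A n \<delta> z0"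
          and E: "\<And>x y. x \<in> P \<Longrightarrow> y \<in> P \<Longrightarrow>
            \<forall>j t. r j < k \<longrightarrow> t \<le> n \<longrightarrow> cmod (?\<phi> j x t - ?\<phi> j y t) \<le> R"
        have "covered (C' * exp (real n * ?h i)) (\<lambda>x y. \<forall>t\<le>n. cmod (?\<phi> i x t - ?\<phi> i y t) \<le> R') P"
        proof (rule scov, intro ballI conjI allI impI)
          fix x y assume xy: "x \<in> P" "y \<in> P"
          with P have O: "x \<in> error_orbits A n \<delta> z0" "y \<in> error_orbits A n \<delta> z0" by auto
          then show "?\<phi> i x 0 = ?\<phi> i y 0" by (simp add: error_orbits_def)
          fix t assume "t < n"
          show "cmod ((?\<phi> i x (Suc t) - ?\<phi> i y (Suc t)) - T $ i $ i * (?\<phi> i x t - ?\<phi> i y t)) \<le> B"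
            unfolding B_def
            by (rule triangular_cover_step[OF QA T \<open>inj r\<close> b O _ \<open>t < n\<close>]) (use E[OF xy] i in auto)
        qed
        then show "covered (C' * exp (real n * ?h i))
          (\<lambda>x y. \<forall>j t. r j < Suc k \<longrightarrow> t \<le> n \<longrightarrow> cmod (?\<phi> j x t - ?\<phi> j y t) \<le> max R R') P"
        proof (rule covered_mono)
          fix x y assume xy: "x \<in> P" "y \<in> P" and *: "\<forall>t\<le>n. cmod (?\<phi> i x t - ?\<phi> i y t) \<le> R'"
          show "\<forall>j t. r j < Suc k \<longrightarrow> t \<le> n \<longrightarrow> cmod (?\<phi> j x t - ?\<phi> j y t) \<le> max R R'"
            using E[OF xy] * by (auto simp: less le_max_iff_disj)
        qed simp
      qed (use C' in simp)
      moreover have "{j. r j < Suc k} = insert i {j. r j < k}" by (auto simp: less)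
      then have "(\<Sum>i | r i < Suc k. ?h i) = ?h i + (\<Sum>i | r i < k. ?h i)"
        using i by (simp only:) (subst sum.insert, auto)
      ultimately show ?thesis
        by (simp add: distrib_left exp_add mult_ac)
    qed
    moreover have "0 < C * C'" using C C' by simp
    ultimately show ?thesis by blast
  qed
qed

lemma linear_orbits_cover:
  fixes A Q T :: "complex ^ 'n ^ 'n"
  assumes QA: "Q ** A = T ** Q" and "invertible Q"
    and T: "\<And>i j. r i < (r j :: nat) \<Longrightarrow> T $ i $ j = 0" and "inj r"
    and "0 < \<epsilon>" "0 \<le> \<delta>"
  shows "\<exists>R C. 0 < C \<and> (\<forall>n. covered
    (C * exp (n * (\<Sum>i\<in>UNIV. 2 * ln (max 1 (cmod (T $ i $ i))) + \<epsilon>)))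
    (\<lambda>x y. \<forall>t\<le>n. norm (x t - y t) \<le> R) (error_orbits A n \<delta> z0))"
proof -
  let ?k = "Suc (Max (range r))"
  have r: "r i < ?k" for i by (simp add: less_Suc_eq_le)
  then have UN: "{i. r i < ?k} = UNIV" by auto
  from triangular_cover[OF QA T \<open>inj r\<close> assms(5,6), of ?k z0] obtain R C where C: "0 < C"
    and cov: "\<And>n. covered (C * exp (real n * (\<Sum>i\<in>UNIV. 2 * ln (max 1 (cmod (T $ i $ i))) + \<epsilon>)))
    (\<lambda>x y. \<forall>i t. r i < ?k \<longrightarrow> t \<le> n \<longrightarrow> cmod ((Q *v x t) $ i - (Q *v y t) $ i) \<le> R)
    (error_orbits A n \<delta> z0)" unfolding UN by blast
  obtain P where P: "P ** Q = mat 1" using \<open>invertible Q\<close> by (auto simp: invertible_def)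
  obtain b where b: "0 < b" "\<And>z. norm (P *v z) \<le> b * norm z"
    using complex_matrix_bound[of P] by blast
  have "covered (C * exp (real n * (\<Sum>i\<in>UNIV. 2 * ln (max 1 (cmod (T $ i $ i))) + \<epsilon>)))
      (\<lambda>x y. \<forall>t\<le>n. norm (x t - y t) \<le> b * (CARD('n) * R)) (error_orbits A n \<delta> z0)" for n
  proof (rule covered_mono[OF cov order_refl], intro allI impI)
    fix x y :: "nat \<Rightarrow> complex ^ 'n" and t
    assume *: "\<forall>i t. r i < ?k \<longrightarrow> t \<le> n \<longrightarrow> cmod ((Q *v x t) $ i - (Q *v y t) $ i) \<le> R" and t: "t \<le> n"
    have "norm (Q *v (x t - y t)) \<le> (\<Sum>i\<in>UNIV. cmod ((Q *v (x t - y t)) $ i))"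
      unfolding norm_vec_def by (rule L2_set_le_sum) simp
    also have "\<dots> \<le> CARD('n) * R"
      using * r t by (intro sum_bounded_above[where A = UNIV and K = R, simplified])
        (simp add: matrix_vector_mult_diff_distrib)
    finally have "b * norm (Q *v (x t - y t)) \<le> b * (CARD('n) * R)" using b(1) by simp
    with b(2)[of "Q *v (x t - y t)"] show "norm (x t - y t) \<le> b * (CARD('n) * R)"
      by (simp add: matrix_vector_mul_assoc P)
  qed
  with C show ?thesis by blast
qed

section \<open>Complexification and the upper bound\<close>

text \<open>
  The complex vector with real part \<open>x\<close> and imaginary part \<open>y\<close>.
\<close>

definition cvec :: "real ^ 'n \<Rightarrow> real ^ 'n \<Rightarrow> complex ^ 'n" where
  "cvec x y = (\<chi> i. Complex (x $ i) (y $ i))"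

text \<open>
  The matrix of the complexification of \<open>f\<close>.
\<close>

definition cmatrix :: "(real ^ 'n \<Rightarrow> real ^ 'n) \<Rightarrow> complex ^ 'n ^ 'n" where
  "cmatrix f = (\<chi> i j. complex_of_real (matrix f $ i $ j))"

lemma cvec_diff: "cvec x y - cvec x' y' = cvec (x - x') (y - y')"
  by (simp add: cvec_def vec_eq_iff complex_eq_iff)

lemma cmatrix_cvec:
  assumes "linear f"
  shows "cmatrix f *v cvec x y = cvec (f x) (f y)"
proof -
  have f: "f u = matrix f *v u" for u
    by (rule matrix_works[OF linear_matrix_vector_mul_eq[THEN iffD2, OF assms], symmetric])
  have "cmatrix f *v cvec x y = cvec (matrix f *v x) (matrix f *v y)"
    by (simp add: cmatrix_def cvec_def vec_eq_iff complex_eq_iff matrix_vector_mult_def Re_sum Im_sum)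
  then show ?thesis by (simp flip: f)
qed

lemma norm_cvec_ge: "norm x \<le> norm (cvec x y)" "norm y \<le> norm (cvec x y)"
proof -
  have "\<bar>x $ i\<bar> \<le> cmod (cvec x y $ i)" "\<bar>y $ i\<bar> \<le> cmod (cvec x y $ i)" for i
    using abs_Re_le_cmod[of "cvec x y $ i"] abs_Im_le_cmod[of "cvec x y $ i"] by (simp_all add: cvec_def)
  then show "norm x \<le> norm (cvec x y)" "norm y \<le> norm (cvec x y)"
    unfolding norm_vec_def by (auto intro!: L2_set_mono)
qed

lemma norm_cvec_le: "norm (cvec x y) \<le> norm x + norm y"
proof -
  have "cvec x y = cvec x 0 + cvec 0 y" by (simp add: cvec_def vec_eq_iff complex_eq_iff)
  moreover have "norm (cvec x 0) = norm x" "norm (cvec 0 y) = norm y"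
    by (simp_all add: cvec_def norm_vec_def cmod_def)
  ultimately show ?thesis using norm_triangle_ineq[of "cvec x 0" "cvec 0 y"] by simp
qed

lemma ext_ln_exp [simp]: "ext_ln (ereal (exp u)) = ereal u"
  by (simp add: ext_ln_def)

lemma affine_rate_tendsto: "((\<lambda>n. ereal (1 / real n) * ereal (a + real n * s)) \<longlongrightarrow> ereal s) sequentially"
proof -
  have "((\<lambda>n. a * (1 / real n) + s) \<longlongrightarrow> a * 0 + s) sequentially"
    by (intro tendsto_intros lim_1_over_n)
  moreover have "\<forall>\<^sub>F n in sequentially. a * (1 / real n) + s = 1 / real n * (a + real n * s)"
    using eventually_gt_at_top[of 0] by eventually_elim (simp add: field_simps)
  ultimately have "((\<lambda>n. 1 / real n * (a + real n * s)) \<longlongrightarrow> s) sequentially"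
    using tendsto_cong by fastforce
  then show ?thesis by simp
qed

lemma sep_growth_le:
  assumes "\<And>n. sep_number f n R \<delta> x0 \<le> ereal (exp (a + real n * s))"
  shows "sep_growth f R \<delta> x0 \<le> ereal s"
proof -
  have "ext_ln (sep_number f n R \<delta> x0) \<le> ereal (a + real n * s)" for n
    using ext_ln_mono[OF assms[of n]] by simp
  then have "sep_growth f R \<delta> x0 \<le> limsup (\<lambda>n. ereal (1 / real n) * ereal (a + real n * s))"
    unfolding sep_growth_def by (intro Limsup_mono always_eventually allI ereal_mult_left_mono) auto
  also have "\<dots> = ereal s" by (intro lim_imp_Limsup affine_rate_tendsto) simp
  finally show ?thesis .
qed

lemma sep_growth_ge:
  assumes "\<And>n. 0 < n \<Longrightarrow> ereal (exp (a + real n * s)) \<le> sep_number f n R \<delta> x0"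
  shows "ereal s \<le> sep_growth f R \<delta> x0"
proof -
  have "ereal s = limsup (\<lambda>n. ereal (1 / real n) * ereal (a + real n * s))"
    by (rule lim_imp_Limsup[symmetric, OF _ affine_rate_tendsto]) simp
  also have "\<dots> \<le> sep_growth f R \<delta> x0"
    unfolding sep_growth_def
  proof (rule Limsup_mono)
    show "\<forall>\<^sub>F n in sequentially. ereal (1 / real n) * ereal (a + real n * s)
        \<le> ereal (1 / real n) * ext_ln (sep_number f n R \<delta> x0)"
      using eventually_gt_at_top[of 0]
    proof eventually_elim
      case (elim n)
      from ext_ln_mono[OF assms[OF elim]]
      have "ereal (a + real n * s) \<le> ext_ln (sep_number f n R \<delta> x0)" by simp
      then show ?case by (rule ereal_mult_left_mono) simp
    qed
  qed
  finally show ?thesis .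
qed

text \<open>
  For a separated set \<open>S\<close> the pairs in \<open>S \<times> S\<close> are pseudoorbits of the complexification, and no two distinct
  ones lie in the same set of the cover; so \<open>(card S)\<^sup>2 \<le> N\<close>.
  The bound \<open>2 \<bar>\<delta>\<bar>\<close> adds the errors of both members of a pair; the absolute value only makes it
  meaningful for \<open>\<delta> < 0\<close>.
\<close>

lemma sep_number_le_sqrt:
  fixes f :: "real ^ 'n \<Rightarrow> real ^ 'n"
  assumes "linear f" "R0 < R"
    and cov: "covered N (\<lambda>x y. \<forall>t\<le>n. norm (x t - y t) \<le> R0)
      (error_orbits (cmatrix f) n (2 * \<bar>\<delta>\<bar>) (cvec x0 x0))"
  shows "sep_number f n R \<delta> x0 \<le> ereal (sqrt N)"
  unfolding sep_number_def
proof (rule SUP_least)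
  fix S assume "S \<in> {S. S \<subseteq> pseudoorbits f n \<delta> x0 \<and> R_separated n R S}"
  then have S: "S \<subseteq> pseudoorbits f n \<delta> x0" and sep: "R_separated n R S" by auto
  define h :: "(real ^ 'n) list \<times> (real ^ 'n) list \<Rightarrow> nat \<Rightarrow> complex ^ 'n"
    where "h = (\<lambda>(xs, ys) t. cvec (xs ! t) (ys ! t))"
  have len: "length xs = Suc n" if "xs \<in> S" for xs using that S by (auto simp: pseudoorbits_def)
  have close_eq: "xs = ys" if "xs \<in> S" "ys \<in> S" "\<And>t. t \<le> n \<Longrightarrow> norm (xs ! t - ys ! t) \<le> R0" for xs ys
  proof (rule ccontr)
    assume "xs \<noteq> ys"
    with sep that have "R \<le> orbit_dist n xs ys" by (auto simp: R_separated_def)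
    moreover have "orbit_dist n xs ys \<le> R0"
      unfolding orbit_dist_def using that(3) by (subst Max_le_iff) (auto simp: dist_norm)
    ultimately show False using \<open>R0 < R\<close> by simp
  qed
  have pair_eq: "p = p'" if p: "p \<in> S \<times> S" "p' \<in> S \<times> S"
    and close: "\<forall>t\<le>n. norm (h p t - h p' t) \<le> R0" for p p'
  proof -
    obtain xs ys xs' ys' where pp: "p = (xs, ys)" "p' = (xs', ys')" by (cases p, cases p')
    have "norm (xs ! t - xs' ! t) \<le> R0" "norm (ys ! t - ys' ! t) \<le> R0" if "t \<le> n" for t
      using close that norm_cvec_ge[of "xs ! t - xs' ! t" "ys ! t - ys' ! t"]
        norm_cvec_ge(2)[of "ys ! t - ys' ! t" "xs ! t - xs' ! t"]
      by (force simp: pp h_def cvec_diff)+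
    with close_eq p show ?thesis by (simp add: pp)
  qed
  have inj: "inj_on h (S \<times> S)"
  proof (rule inj_onI)
    fix p p' assume p: "p \<in> S \<times> S" "p' \<in> S \<times> S" "h p = h p'"
    obtain xs ys xs' ys' where pp: "p = (xs, ys)" "p' = (xs', ys')" by (cases p, cases p')
    have "xs ! t = xs' ! t" "ys ! t = ys' ! t" for t
      using p(3) unfolding pp h_def by (auto simp: fun_eq_iff cvec_def vec_eq_iff)
    with p len show "p = p'" by (auto simp: pp intro!: nth_equalityI)
  qed
  have sub: "h ` (S \<times> S) \<subseteq> error_orbits (cmatrix f) n (2 * \<bar>\<delta>\<bar>) (cvec x0 x0)"
  proof (intro image_subsetI)
    fix p assume "p \<in> S \<times> S"
    then obtain xs ys where p: "p = (xs, ys)" "xs \<in> S" "ys \<in> S" by auto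
    have "norm (h p (Suc t) - cmatrix f *v h p t) \<le> 2 * \<bar>\<delta>\<bar>" if "t < n" for t
    proof -
      have "norm (xs ! Suc t - f (xs ! t)) \<le> \<delta>" "norm (ys ! Suc t - f (ys ! t)) \<le> \<delta>"
        using p S that by (auto simp: pseudoorbits_def dist_norm norm_minus_commute)
      moreover have "h p (Suc t) - cmatrix f *v h p t = cvec (xs ! Suc t - f (xs ! t)) (ys ! Suc t - f (ys ! t))"
        by (simp add: p h_def cmatrix_cvec[OF \<open>linear f\<close>] cvec_diff)
      ultimately show ?thesis
        using norm_cvec_le[of "xs ! Suc t - f (xs ! t)" "ys ! Suc t - f (ys ! t)"] by simp
    qed
    moreover have "xs ! 0 = x0" "ys ! 0 = x0" using p S by (auto simp: pseudoorbits_def)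
    then have "h p 0 = cvec x0 x0" by (simp add: p(1) h_def)
    ultimately show "h p \<in> error_orbits (cmatrix f) n (2 * \<bar>\<delta>\<bar>) (cvec x0 x0)"
      by (simp add: error_orbits_def)
  qed
  have fin: "finite (h ` (S \<times> S)) \<and> real (card (h ` (S \<times> S))) \<le> N"
    by (rule card_separated_le_covered[OF cov sub]) (use pair_eq in blast)
  then have "finite (S \<times> S)" using inj by (metis finite_imageD)
  then have "finite S" by (cases "S = {}") (auto dest: finite_cartesian_productD1)
  moreover have "real (card S) * real (card S) \<le> N"
    using fin card_image[OF inj] by (simp add: card_cartesian_product)
  then have "real (card S) \<le> sqrt N"
    by (intro real_le_rsqrt) (simp add: power2_eq_square)
  ultimately show "ext_card S \<le> ereal (sqrt N)" by (simp add: ext_card_def)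
qed

lemma coarse_entropy_eq_SUP_INF:
  "coarse_entropy f x0 = (SUP \<delta>. INF R. sep_growth f R \<delta> x0)"
proof -
  have "mono (\<lambda>\<delta>. INF R. sep_growth f R \<delta> x0)"
    by (intro monoI INF_mono') (simp add: sep_growth_mono)
  from mono_tendsto_SUP[OF this] show ?thesis
    unfolding coarse_entropy_def Lim_sep_growth by (simp add: tendsto_Lim)
qed

lemma coarse_entropy_le:
  fixes f :: "real ^ 'n \<Rightarrow> real ^ 'n" and Q T :: "complex ^ 'n ^ 'n"
  assumes "linear f" and QA: "Q ** cmatrix f = T ** Q" and "invertible Q"
    and T: "\<And>i j. r i < (r j :: nat) \<Longrightarrow> T $ i $ j = 0" and "inj r"
  shows "coarse_entropy f x0 \<le> ereal (\<Sum>i\<in>UNIV. ln (max 1 (cmod (T $ i $ i))))"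
  unfolding coarse_entropy_eq_SUP_INF
proof (rule SUP_least)
  fix \<delta> :: real
  let ?s = "\<Sum>i\<in>UNIV. ln (max 1 (cmod (T $ i $ i)))"
  show "(INF R. sep_growth f R \<delta> x0) \<le> ereal ?s"
  proof (rule ereal_le_epsilon2)
    fix e :: real assume "0 < e"
    \<comment> \<open>The \<open>\<epsilon>\<close> spent in each coordinate adds up to \<open>2 e\<close>, and the square root halves it.\<close>
    define \<epsilon> where "\<epsilon> = 2 * e / CARD('n)"
    have "0 < \<epsilon>" using \<open>0 < e\<close> by (simp add: \<epsilon>_def)
    have "0 \<le> 2 * \<bar>\<delta>\<bar>" by simp
    from linear_orbits_cover[OF QA \<open>invertible Q\<close> T \<open>inj r\<close> \<open>0 < \<epsilon>\<close> this, of "cvec x0 x0"]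
    obtain R C where C: "0 < C" and cov: "\<And>n. covered
        (C * exp (real n * (\<Sum>i\<in>UNIV. 2 * ln (max 1 (cmod (T $ i $ i))) + \<epsilon>)))
        (\<lambda>x y. \<forall>t\<le>n. norm (x t - y t) \<le> R) (error_orbits (cmatrix f) n (2 * \<bar>\<delta>\<bar>) (cvec x0 x0))"
      by blast
    have "(\<Sum>i\<in>UNIV. 2 * ln (max 1 (cmod (T $ i $ i))) + \<epsilon>) = 2 * (?s + e)"
      by (simp add: sum.distrib sum_distrib_left[symmetric] \<epsilon>_def)
    moreover have "C * exp (real n * (2 * (?s + e))) = (exp (ln C / 2 + real n * (?s + e)))\<^sup>2" for n
      using C by (simp add: power2_eq_square exp_add[symmetric]) (simp add: exp_add algebra_simps)
    ultimately have "sep_number f n (R + 1) \<delta> x0 \<le> ereal (exp (ln C / 2 + real n * (?s + e)))" for n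
      using sep_number_le_sqrt[OF \<open>linear f\<close> _ cov[of n], of "R + 1"] by simp
    then have "sep_growth f (R + 1) \<delta> x0 \<le> ereal (?s + e)" by (rule sep_growth_le)
    then show "(INF R. sep_growth f R \<delta> x0) \<le> ereal ?s + ereal e"
      using INF_lower2[of "R + 1" UNIV "\<lambda>R. sep_growth f R \<delta> x0"] by simp
  qed
qed

section \<open>The lower bound\<close>

text \<open>
  A separated set of maximal cardinality is \<open>R\<close>-dense among the pseudoorbits.
\<close>

lemma maximal_separated_set:
  assumes "sep_number f n R \<delta> x0 \<noteq> \<infinity>" "0 < R"
  obtains S where "S \<subseteq> pseudoorbits f n \<delta> x0" "finite S"
    "ereal (card S) \<le> sep_number f n R \<delta> x0"
    "\<And>xs. xs \<in> pseudoorbits f n \<delta> x0 \<Longrightarrow> \<exists>s\<in>S. orbit_dist n xs s < R"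
proof -
  let ?A = "\<lambda>S. S \<subseteq> pseudoorbits f n \<delta> x0 \<and> R_separated n R S"
  have up: "ext_card S \<le> sep_number f n R \<delta> x0" if "?A S" for S
    unfolding sep_number_def using that by (intro SUP_upper) auto
  have "?A {}" by (simp add: R_separated_def)
  from up[OF this] have "0 \<le> sep_number f n R \<delta> x0" by (simp add: ext_card_def zero_ereal_def)
  with assms(1) obtain N where N: "sep_number f n R \<delta> x0 = ereal N"
    by (cases "sep_number f n R \<delta> x0") auto
  have fin: "finite S \<and> real (card S) \<le> N" if "?A S" for S
    using up[OF that] by (auto simp: N ext_card_def split: if_splits)
  have "\<forall>S. ?A S \<longrightarrow> card S < Suc (nat \<lceil>N\<rceil>)"
  proof (intro allI impI)
    fix S assume "?A S"
    from fin[OF this] real_nat_ceiling_ge[of N] show "card S < Suc (nat \<lceil>N\<rceil>)" by linarith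
  qed
  then obtain S where S: "?A S" and max: "\<And>S'. ?A S' \<Longrightarrow> card S' \<le> card S"
    using ex_has_greatest_nat[of ?A "{}" card] \<open>?A {}\<close> by metis
  have "\<exists>s\<in>S. orbit_dist n xs s < R" if xs: "xs \<in> pseudoorbits f n \<delta> x0" for xs
  proof (rule ccontr)
    assume neg: "\<not> (\<exists>s\<in>S. orbit_dist n xs s < R)"
    have "orbit_dist n xs xs = 0" by (simp add: orbit_dist_def)
    then have "xs \<notin> S" using neg assms(2) by auto
    have far: "R \<le> orbit_dist n xs s" if "s \<in> S" for s
      using neg that by (auto simp: not_less)
    moreover have "R \<le> orbit_dist n s xs" if "s \<in> S" for s
      using far[OF that] by (simp add: orbit_dist_def dist_commute)
    ultimately have "?A (insert xs S)" using S xs by (auto simp: R_separated_def)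
    from max[OF this] \<open>xs \<notin> S\<close> fin[OF S] show False by simp
  qed
  with S fin[OF S] show ?thesis by (intro that[of S]) (auto simp: N)
qed

text \<open>
  The pseudoorbit \<open>x\<^sub>0, f x\<^sub>0 + e, f (f x\<^sub>0 + e), \<dots>\<close> of length \<open>n\<close>, whose only error is \<open>e\<close> in the first step.
\<close>

definition kicked_orbit :: "('a::real_normed_vector \<Rightarrow> 'a) \<Rightarrow> nat \<Rightarrow> 'a \<Rightarrow> 'a \<Rightarrow> 'a list" where
  "kicked_orbit f n x0 e = x0 # map (\<lambda>i. (f ^^ i) (f x0 + e)) [0..<n]"

lemma kicked_orbit_pseudoorbit:
  assumes "norm e \<le> \<delta>"
  shows "kicked_orbit f n x0 e \<in> pseudoorbits f n \<delta> x0"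
proof -
  have "0 \<le> \<delta>" using assms norm_ge_zero order_trans by blast
  have "dist (f (kicked_orbit f n x0 e ! i)) (kicked_orbit f n x0 e ! Suc i) \<le> \<delta>" if "i < n" for i
    using that assms \<open>0 \<le> \<delta>\<close> by (cases i) (simp_all add: kicked_orbit_def dist_norm)
  then show ?thesis by (simp add: pseudoorbits_def kicked_orbit_def)
qed

lemma kicked_orbit_last_dist:
  assumes "linear f"
  shows "norm ((f ^^ m) (a - b)) \<le>
    dist (kicked_orbit f (Suc m) x0 a ! Suc m) (kicked_orbit f (Suc m) x0 b ! Suc m)"
proof -
  have "linear (f ^^ m)"
    by (induction m) (simp_all only: funpow.simps linear_id linear_compose[OF _ assms])
  from linear_diff[OF this, of "f x0 + a" "f x0 + b"] show ?thesis
    by (simp add: kicked_orbit_def dist_norm del: upt_Suc)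
qed

text \<open>
  Real and imaginary part of an error \<open>e i\<close> give two pseudoorbits of \<open>f\<close>, each within \<open>R\<close> of a member of a
  maximal separated set \<open>S\<close>. Since distinct errors end up at distance at least \<open>4 R\<close>, this defines an
  injection into \<open>S \<times> S\<close>.
\<close>

lemma sqrt_card_le_sep_number:
  fixes f :: "real ^ 'n \<Rightarrow> real ^ 'n"
  assumes "linear f" "0 < R" "finite I"
    and small: "\<And>i. i \<in> I \<Longrightarrow> norm (e i) \<le> \<delta>"
    and sep: "\<And>i j. i \<in> I \<Longrightarrow> j \<in> I \<Longrightarrow> i \<noteq> j \<Longrightarrow>
      4 * R \<le> norm ((((*v) (cmatrix f)) ^^ m) (e i - e j))"
  shows "ereal (sqrt (card I)) \<le> sep_number f (Suc m) R \<delta> x0"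
proof (cases "sep_number f (Suc m) R \<delta> x0 = \<infinity>")
  case False
  from maximal_separated_set[OF this \<open>0 < R\<close>] obtain S where
    S: "finite S" "ereal (card S) \<le> sep_number f (Suc m) R \<delta> x0"
    and near: "\<And>xs. xs \<in> pseudoorbits f (Suc m) \<delta> x0 \<Longrightarrow> \<exists>s\<in>S. orbit_dist (Suc m) xs s < R"
    by metis
  let ?k = "kicked_orbit f (Suc m) x0"
  define re where "re i = (\<chi> k. Re (e i $ k))" for i
  define im where "im i = (\<chi> k. Im (e i $ k))" for i
  have e: "e i = cvec (re i) (im i)" for i
    by (simp add: re_def im_def cvec_def vec_eq_iff)
  obtain p where p: "\<And>xs. xs \<in> pseudoorbits f (Suc m) \<delta> x0 \<Longrightarrow> p xs \<in> S \<and> orbit_dist (Suc m) xs (p xs) < R"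
    using near by metis
  have k: "?k (re i) \<in> pseudoorbits f (Suc m) \<delta> x0" "?k (im i) \<in> pseudoorbits f (Suc m) \<delta> x0"
    if "i \<in> I" for i
    using small[OF that] norm_cvec_ge[of "re i" "im i"] norm_cvec_ge(2)[of "im i" "re i"]
    by (auto intro!: kicked_orbit_pseudoorbit simp flip: e)
  have close: "norm ((f ^^ m) (a - b)) < 2 * R"
    if "?k a \<in> pseudoorbits f (Suc m) \<delta> x0" "?k b \<in> pseudoorbits f (Suc m) \<delta> x0" "p (?k a) = p (?k b)" for a b
  proof -
    have last: "dist (xs ! Suc m) (ys ! Suc m) \<le> orbit_dist (Suc m) xs ys" for xs ys :: "(real ^ 'n) list"
      unfolding orbit_dist_def by (intro Max_ge) auto
    from last[of "?k a" "p (?k a)"] last[of "?k b" "p (?k b)"] p[OF that(1)] p[OF that(2)]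
    have "dist (?k a ! Suc m) (p (?k a) ! Suc m) < R" "dist (?k b ! Suc m) (p (?k a) ! Suc m) < R"
      by (auto simp: that(3))
    then have "dist (?k a ! Suc m) (?k b ! Suc m) < 2 * R"
      using dist_triangle2[of "?k a ! Suc m" "?k b ! Suc m" "p (?k a) ! Suc m"] by linarith
    with kicked_orbit_last_dist[OF \<open>linear f\<close>, of m a b x0] show ?thesis by linarith
  qed
  have iter: "((*v) (cmatrix f) ^^ m) (cvec a b) = cvec ((f ^^ m) a) ((f ^^ m) b)" for a b
    by (induction m) (simp_all add: cmatrix_cvec[OF \<open>linear f\<close>])
  have "inj_on (\<lambda>i. (p (?k (re i)), p (?k (im i)))) I"
  proof (rule inj_onI, rule ccontr)
    fix i j assume ij: "i \<in> I" "j \<in> I" "i \<noteq> j"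
      and eq: "(p (?k (re i)), p (?k (im i))) = (p (?k (re j)), p (?k (im j)))"
    have "norm ((f ^^ m) (re i - re j)) < 2 * R" "norm ((f ^^ m) (im i - im j)) < 2 * R"
      using eq ij k by (auto intro!: close)
    moreover have "norm (((*v) (cmatrix f) ^^ m) (e i - e j)) \<le>
        norm ((f ^^ m) (re i - re j)) + norm ((f ^^ m) (im i - im j))"
      by (simp add: e cvec_diff iter norm_cvec_le)
    ultimately show False using sep[OF ij] by linarith
  qed
  moreover have "(\<lambda>i. (p (?k (re i)), p (?k (im i)))) ` I \<subseteq> S \<times> S"
    using p k by auto
  ultimately have "card I \<le> card (S \<times> S)"
    using S(1) by (intro card_inj_on_le) auto
  then have "real (card I) \<le> real (card S) * real (card S)"
    by (metis card_cartesian_product of_nat_le_iff of_nat_mult)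
  then have "sqrt (card I) \<le> card S"
    by (intro real_le_lsqrt) (auto simp: power2_eq_square)
  then show ?thesis using S(2) by (meson ereal_less_eq(3) order_trans)
qed simp

text \<open>
  A set of points in the disc of radius \<open>\<eta>\<close> which multiplication by \<open>c\<^sup>m\<close> makes \<open>\<rho>\<close>-separated: a square
  grid of mesh \<open>\<rho> / \<bar>c\<bar>\<^sup>m\<close> if \<open>\<bar>c\<bar> > 1\<close>, and a single point otherwise.
\<close>

lemma expanding_grid:
  fixes c :: complex
  assumes "0 < \<eta>" "0 < \<rho>" and \<kappa>: "\<kappa> = min 1 (\<eta> / (2 * \<rho>))"
  shows "\<exists>G. finite G \<and> (\<forall>u\<in>G. cmod u \<le> \<eta>) \<and>
    (\<forall>u\<in>G. \<forall>v\<in>G. u \<noteq> v \<longrightarrow> \<rho> \<le> cmod c ^ m * cmod (u - v)) \<and>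
    (\<kappa> * max 1 (cmod c) ^ m)\<^sup>2 \<le> real (card G)"
proof (cases "cmod c \<le> 1")
  case True
  have "0 \<le> \<kappa>" "\<kappa> \<le> 1" using assms by auto
  then have "(\<kappa> * max 1 (cmod c) ^ m)\<^sup>2 \<le> 1"
    using True by (simp add: max_def power_le_one)
  then show ?thesis using assms(1) by (intro exI[of _ "{0}"]) auto
next
  case False
  define s where "s = \<rho> / cmod c ^ m"
  have cm: "0 < cmod c ^ m" using False by (intro zero_less_power) linarith
  have s: "0 < s" using cm assms(2) by (simp add: s_def)
  define M where "M = nat \<lfloor>\<eta> / (2 * s)\<rfloor>"
  let ?g = "\<lambda>(a::nat, b::nat). complex_of_real s * Complex (real a) (real b)"
  let ?G = "?g ` ({..M} \<times> {..M})"
  have inj: "inj_on ?g ({..M} \<times> {..M})"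
    using s by (auto simp: inj_on_def)
  have M: "real M \<le> \<eta> / (2 * s)" "\<eta> / (2 * s) \<le> real M + 1"
    using assms(1) s by (simp_all add: M_def)
  have "cmod u \<le> \<eta>" if "u \<in> ?G" for u
  proof -
    from that obtain a b where ab: "a \<le> M" "b \<le> M" "u = ?g (a, b)" by auto
    have "cmod (Complex (real a) (real b)) \<le> real a + real b"
      using cmod_le[of "Complex (real a) (real b)"] by simp
    also have "\<dots> \<le> 2 * (\<eta> / (2 * s))" using ab(1,2) M(1) by linarith
    finally have "s * cmod (Complex (real a) (real b)) \<le> s * (2 * (\<eta> / (2 * s)))"
      using s by (intro mult_left_mono) auto
    then show ?thesis using s by (simp add: ab(3) norm_mult)
  qed
  moreover have "\<rho> \<le> cmod c ^ m * cmod (u - v)" if "u \<in> ?G" "v \<in> ?G" "u \<noteq> v" for u v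
  proof -
    from that obtain a b a' b' where ab: "u = ?g (a, b)" "v = ?g (a', b')" by auto
    let ?d = "Complex (real a) (real b) - Complex (real a') (real b')"
    have "a \<noteq> a' \<or> b \<noteq> b'" using that(3) ab by auto
    then have "1 \<le> \<bar>Re ?d\<bar> \<or> 1 \<le> \<bar>Im ?d\<bar>" by auto
    then have "1 \<le> cmod ?d" using abs_Re_le_cmod[of ?d] abs_Im_le_cmod[of ?d] by linarith
    moreover have "u - v = complex_of_real s * ?d" by (simp add: ab right_diff_distrib)
    then have "cmod (u - v) = s * cmod ?d" using s by (simp only: norm_mult) simp
    ultimately have "s \<le> cmod (u - v)" using s by simp
    then have "cmod c ^ m * s \<le> cmod c ^ m * cmod (u - v)" using cm by simp
    moreover have "c \<noteq> 0" using False by auto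
    ultimately show ?thesis by (simp add: s_def)
  qed
  moreover have "(\<kappa> * max 1 (cmod c) ^ m)\<^sup>2 \<le> real (card ?G)"
  proof -
    have "max 1 (cmod c) = cmod c" using False by simp
    moreover have "\<kappa> \<le> \<eta> / (2 * \<rho>)" by (simp add: \<kappa>)
    ultimately have "\<kappa> * max 1 (cmod c) ^ m \<le> \<eta> / (2 * \<rho>) * cmod c ^ m"
      using cm by (simp only: mult_right_mono less_imp_le)
    also have "\<dots> = \<eta> / (2 * s)" using cm by (simp add: s_def)
    also have "\<dots> \<le> real M + 1" by (rule M(2))
    finally have "(\<kappa> * max 1 (cmod c) ^ m)\<^sup>2 \<le> (real M + 1)\<^sup>2"
      using assms by (intro power_mono) auto
    also have "\<dots> = real (card ?G)"
      by (simp add: card_image[OF inj] power2_eq_square algebra_simps)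
    finally show ?thesis .
  qed
  ultimately show ?thesis by (intro exI[of _ ?G]) auto
qed

text \<open>
  If all coordinates of rank below \<open>r i\<close> vanish, they remain zero under iteration, and the \<open>i\<close>-th
  coordinate is just multiplied by \<open>T\<^sub>i\<^sub>i\<close>.
\<close>

lemma triangular_first_coordinate:
  fixes A Q T :: "complex ^ 'n ^ 'n"
  assumes QA: "Q ** A = T ** Q"
    and T: "\<And>i j. r i < (r j :: nat) \<Longrightarrow> T $ i $ j = 0" and "inj r"
    and zero: "\<And>j. r j < r i \<Longrightarrow> (Q *v w) $ j = 0"
  shows "(Q *v (((*v) A ^^ m) w)) $ i = T $ i $ i ^ m * (Q *v w) $ i"
proof -
  have "(\<forall>j. r j < r i \<longrightarrow> (Q *v (((*v) A ^^ m) w)) $ j = 0) \<and>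
      (Q *v (((*v) A ^^ m) w)) $ i = T $ i $ i ^ m * (Q *v w) $ i"
  proof (induction m)
    case 0
    then show ?case using zero by simp
  next
    case (Suc m)
    let ?u = "Q *v (((*v) A ^^ m) w)"
    have step: "Q *v (((*v) A ^^ Suc m) w) = T *v ?u"
      by (simp add: matrix_vector_mul_assoc QA)
    have diag: "(T *v ?u) $ j = T $ j $ j * ?u $ j" if "r j \<le> r i" for j
    proof -
      have "T $ j $ l * ?u $ l = 0" if "l \<noteq> j" for l
      proof (cases "r l < r j")
        case True
        with \<open>r j \<le> r i\<close> Suc show ?thesis by simp
      next
        case False
        with that \<open>inj r\<close> have "r j < r l" by (metis injD linorder_neqE_nat)
        then show ?thesis by (simp add: T)
      qed
      then have "(\<Sum>l\<in>UNIV. T $ j $ l * ?u $ l) = (\<Sum>l\<in>{j}. T $ j $ l * ?u $ l)"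
        by (intro sum.mono_neutral_right) auto
      then show ?thesis by (simp add: matrix_vector_mult_def)
    qed
    show ?case unfolding step using diag Suc by auto
  qed
  then show ?thesis by blast
qed

lemma coarse_entropy_ge:
  fixes f :: "real ^ 'n \<Rightarrow> real ^ 'n" and Q T :: "complex ^ 'n ^ 'n"
  assumes "linear f" and QA: "Q ** cmatrix f = T ** Q" and "invertible Q"
    and T: "\<And>i j. r i < (r j :: nat) \<Longrightarrow> T $ i $ j = 0" and "inj r"
  shows "ereal (\<Sum>i\<in>UNIV. ln (max 1 (cmod (T $ i $ i)))) \<le> coarse_entropy f x0"
proof -
  let ?s = "\<Sum>i\<in>UNIV. ln (max 1 (cmod (T $ i $ i)))"
  obtain P where P: "Q ** P = mat 1" using \<open>invertible Q\<close> by (auto simp: invertible_def)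
  obtain b where b: "0 < b" "\<And>z. norm (P *v z) \<le> b * norm z"
    using complex_matrix_bound[of P] by blast
  obtain b' where b': "0 < b'" "\<And>z. norm (Q *v z) \<le> b' * norm z"
    using complex_matrix_bound[of Q] by blast
  \<comment> \<open>Errors whose coordinates are bounded by \<open>\<eta>\<close> have norm at most \<open>1\<close>.\<close>
  define \<eta> where "\<eta> = 1 / (b * CARD('n))"
  have \<eta>: "0 < \<eta>" using b(1) by (simp add: \<eta>_def)
  have "ereal ?s \<le> sep_growth f R 1 x0" if "0 < R" for R
  proof -
    define \<kappa> where "\<kappa> = min 1 (\<eta> / (2 * (b' * (4 * R))))"
    have \<kappa>: "0 < \<kappa>" using \<eta> b'(1) that by (simp add: \<kappa>_def)
    have "ereal (exp ((CARD('n) * ln \<kappa> - ?s) + n * ?s)) \<le> sep_number f n R 1 x0" if "0 < n" for n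
    proof -
      from that obtain m where n: "n = Suc m" using gr0_implies_Suc by blast
      have "0 < b' * (4 * R)" using b'(1) \<open>0 < R\<close> by simp
      have "\<forall>i. \<exists>G. finite G \<and> (\<forall>u\<in>G. cmod u \<le> \<eta>) \<and>
        (\<forall>u\<in>G. \<forall>v\<in>G. u \<noteq> v \<longrightarrow> b' * (4 * R) \<le> cmod (T $ i $ i) ^ m * cmod (u - v)) \<and>
        (\<kappa> * max 1 (cmod (T $ i $ i)) ^ m)\<^sup>2 \<le> real (card G)"
        by (intro allI expanding_grid[OF \<eta> \<open>0 < b' * (4 * R)\<close> \<kappa>_def])
      then obtain G where G: "\<And>i. finite (G i)" "\<And>i u. u \<in> G i \<Longrightarrow> cmod u \<le> \<eta>"
        "\<And>i u v. u \<in> G i \<Longrightarrow> v \<in> G i \<Longrightarrow> u \<noteq> v \<Longrightarrow> b' * (4 * R) \<le> cmod (T $ i $ i) ^ m * cmod (u - v)"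
        "\<And>i. (\<kappa> * max 1 (cmod (T $ i $ i)) ^ m)\<^sup>2 \<le> real (card (G i))"
        by metis
      define e where "e \<phi> = P *v (\<chi> i. \<phi> i)" for \<phi> :: "'n \<Rightarrow> complex"
      have Qe: "(Q *v e \<phi>) $ i = \<phi> i" for \<phi> i by (simp add: e_def matrix_vector_mul_assoc P)
      let ?I = "Pi\<^sub>E UNIV G"
      have "ereal (sqrt (card ?I)) \<le> sep_number f (Suc m) R 1 x0"
      proof (rule sqrt_card_le_sep_number[OF \<open>linear f\<close> \<open>0 < R\<close>, where e = e])
        show "finite ?I" using G(1) by (intro finite_PiE) auto
        fix \<phi> assume \<phi>: "\<phi> \<in> ?I"
        have "norm (\<chi> i. \<phi> i) \<le> (\<Sum>i\<in>UNIV. cmod ((\<chi> i. \<phi> i) $ i))"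
          unfolding norm_vec_def by (rule L2_set_le_sum) simp
        also have "\<dots> \<le> CARD('n) * \<eta>"
          using \<phi> G(2) by (intro sum_bounded_above[where A = UNIV and K = \<eta>, simplified]) auto
        finally have "b * norm (\<chi> i. \<phi> i) \<le> b * (CARD('n) * \<eta>)" using b(1) by simp
        with b(2)[of "\<chi> i. \<phi> i"] show "norm (e \<phi>) \<le> 1"
          using b(1) by (simp add: e_def \<eta>_def)
        fix \<psi> assume \<psi>: "\<psi> \<in> ?I" and "\<phi> \<noteq> \<psi>"
        then obtain i0 where "\<phi> i0 \<noteq> \<psi> i0" by auto
        then obtain i where i: "\<phi> i \<noteq> \<psi> i" and "\<And>j. \<phi> j \<noteq> \<psi> j \<Longrightarrow> r i \<le> r j"
          using ex_has_least_nat[of "\<lambda>i. \<phi> i \<noteq> \<psi> i" i0 r] by blast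
        then have min: "\<phi> j = \<psi> j" if "r j < r i" for j using that not_less by blast
        let ?v = "((*v) (cmatrix f) ^^ m) (e \<phi> - e \<psi>)"
        have "(Q *v (e \<phi> - e \<psi>)) $ j = \<phi> j - \<psi> j" for j
          by (simp add: matrix_vector_mult_diff_distrib Qe)
        with triangular_first_coordinate[OF QA T \<open>inj r\<close>, of i "e \<phi> - e \<psi>" m] min
        have "(Q *v ?v) $ i = T $ i $ i ^ m * (\<phi> i - \<psi> i)" by simp
        then have "b' * (4 * R) \<le> cmod ((Q *v ?v) $ i)"
          using G(3)[of "\<phi> i" i "\<psi> i"] \<phi> \<psi> i by (auto simp: norm_mult norm_power)
        also have "\<dots> \<le> b' * norm ?v"
          using Finite_Cartesian_Product.norm_nth_le b'(2) order_trans by blast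
        finally show "4 * R \<le> norm ?v" using b'(1) by simp
      qed
      moreover have "exp ((CARD('n) * ln \<kappa> - ?s) + n * ?s) \<le> sqrt (card ?I)"
      proof (rule real_le_rsqrt)
        have "exp ((CARD('n) * ln \<kappa> - ?s) + n * ?s) = exp (\<Sum>i\<in>UNIV. ln \<kappa> + m * ln (max 1 (cmod (T $ i $ i))))"
          by (simp add: n sum.distrib sum_distrib_left algebra_simps)
        also have "\<dots> = (\<Prod>i\<in>UNIV. \<kappa> * max 1 (cmod (T $ i $ i)) ^ m)"
          using \<kappa> by (simp add: exp_sum exp_add exp_of_nat_mult)
        finally have "(exp ((CARD('n) * ln \<kappa> - ?s) + n * ?s))\<^sup>2 =
            (\<Prod>i\<in>UNIV. (\<kappa> * max 1 (cmod (T $ i $ i)) ^ m)\<^sup>2)"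
          by (simp only: prod_power_distrib)
        also have "\<dots> \<le> (\<Prod>i\<in>UNIV. real (card (G i)))"
          using G(4) by (intro prod_mono) auto
        also have "\<dots> = card ?I" by (simp add: card_PiE)
        finally show "(exp ((CARD('n) * ln \<kappa> - ?s) + n * ?s))\<^sup>2 \<le> real (card ?I)" .
      qed
      ultimately show ?thesis unfolding n by (meson ereal_less_eq(3) order_trans)
    qed
    then show ?thesis by (rule sep_growth_ge)
  qed
  note pos = this
  have "ereal ?s \<le> sep_growth f R 1 x0" for R
    using pos[of "max R 1"] sep_growth_mono[of R "max R 1" 1 1 f x0] order_trans by fastforce
  then have "ereal ?s \<le> (INF R. sep_growth f R 1 x0)" by (intro INF_greatest)
  also have "\<dots> \<le> coarse_entropy f x0"
    unfolding coarse_entropy_eq_SUP_INF by (rule SUP_upper) simp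
  finally show ?thesis .
qed

theorem theorem4p3:
  fixes f :: "real ^ 'q \<Rightarrow> real ^ 'q"
    and x0 :: "real ^ 'q"
    and \<Lambda> :: real
  assumes "linear f"
    and "\<Lambda> = cmod (\<Prod>z \<in># filter_mset (\<lambda>z. cmod z > 1) (complex_eigenvalues f). z)"
  shows "coarse_entropy f x0 = ereal (ln \<Lambda>)"
proof -
  obtain Q T :: "complex ^ 'q ^ 'q" and r :: "'q \<Rightarrow> nat" where
    Q: "Q ** cmatrix f = T ** Q" "invertible Q" and
    T: "\<And>i j. r i < r j \<Longrightarrow> T $ i $ j = 0" and r: "inj r"
    using triangularization[of "cmatrix f"] by metis
  have "complex_eigenvalues f = proots (\<Prod>i\<in>UNIV. [:- T $ i $ i, 1:])"
    using charpoly_triangularization[OF Q(2,1) r T]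
    by (simp add: complex_eigenvalues_def cmatrix_def)
  then have "\<Lambda> = (\<Prod>i\<in>UNIV. max 1 (cmod (T $ i $ i)))"
    using assms(2) norm_prod_roots_outside[of UNIV "\<lambda>i. T $ i $ i"] by simp
  then have "ln \<Lambda> = (\<Sum>i\<in>UNIV. ln (max 1 (cmod (T $ i $ i))))"
    by (simp add: ln_prod)
  then show ?thesis
    using coarse_entropy_le[OF assms(1) Q T r, of x0] coarse_entropy_ge[OF assms(1) Q T r, of x0]
    by (intro antisym) auto
qed

end
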